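(* Let $n\ge 2$ and let $\alpha_1,\ldots,\alpha_n$ be pairwise distinct totally real algebraic numbers. Then there is a positive constant $C=C(n,\alpha_1,\ldots,\alpha_n)$ such that for every totally real algebraic integer $t$ with $\overline{|t|}\ge C$, the $n$ algebraic numbers $\alpha_1+t,\ldots,\alpha_n+t$ are multiplicatively independent.
   Context: For an algebraic number $\alpha$ with conjugates $\alpha_1,\dots,\alpha_m$ over $\mathbb{Q}$, the house of $\alpha$ is $\overline{|\alpha|}=\max\{|\alpha_1|,\ldots,|\alpha_m|\}$. Non-zero complex numbers $z_1,\dots,z_n$ are multiplicatively dependent if there is a non-zero integer vector $(k_1,\dots,k_n)\in\mathbb{Z}^n$ with $z_1^{k_1}\cdots z_n^{k_n}=1$, and multiplicatively independent otherwise; a tuple of complex numbers is called multiplicatively dependent (resp. independent) only if all its coordinates are non-zero and they are multiplicatively dependent (resp. independent). *)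

theory Defs
  imports "HOL-Computational_Algebra.Computational_Algebra" "HOL-Analysis.Analysis"
begin

(* Meaningful for algebraic x only; existence and uniqueness in that case are
   rat_min_poly_ex1 below. *)
definition rat_min_poly :: "complex \<Rightarrow> rat poly" where
  "rat_min_poly x =
     (THE p. lead_coeff p = 1 \<and> irreducible p \<and> poly (map_poly of_rat p) x = 0)"

definition conjugates :: "complex \<Rightarrow> complex set" where
  "conjugates x = {y. poly (map_poly of_rat (rat_min_poly x)) y = 0}"

definition house :: "complex \<Rightarrow> real" where
  "house x = Max (norm ` conjugates x)"

definition totally_real :: "complex \<Rightarrow> bool" where
  "totally_real x \<longleftrightarrow> algebraic x \<and> conjugates x \<subseteq> \<real>"

definition mult_dependent :: "nat \<Rightarrow> (nat \<Rightarrow> complex) \<Rightarrow> bool" where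
  "mult_dependent n z \<longleftrightarrow> (\<forall>i\<in>{1..n}. z i \<noteq> 0) \<and>
     (\<exists>k :: nat \<Rightarrow> int. (\<exists>i\<in>{1..n}. k i \<noteq> 0) \<and> (\<Prod>i=1..n. z i powi k i) = 1)"

(* Not the plain negation of mult_dependent: a tuple with a zero coordinate is neither. *)
definition mult_independent :: "nat \<Rightarrow> (nat \<Rightarrow> complex) \<Rightarrow> bool" where
  "mult_independent n z \<longleftrightarrow> (\<forall>i\<in>{1..n}. z i \<noteq> 0) \<and> \<not> mult_dependent n z"

lemma map_poly_of_rat_mult:
  "map_poly (of_rat :: rat \<Rightarrow> complex) (p * q) = map_poly of_rat p * map_poly of_rat q"
  by (intro poly_eqI) (simp add: coeff_map_poly coeff_mult of_rat_sum of_rat_mult)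

lemma map_poly_of_rat_add:
  "map_poly (of_rat :: rat \<Rightarrow> complex) (p + q) = map_poly of_rat p + map_poly of_rat q"
  by (intro poly_eqI) (simp add: coeff_map_poly of_rat_add)

lemma map_poly_of_rat_eq_0_iff:
  "map_poly (of_rat :: rat \<Rightarrow> complex) p = 0 \<longleftrightarrow> p = 0"
  by (simp add: poly_eq_iff coeff_map_poly)

lemma algebraic_rat_poly:
  assumes "algebraic (x :: complex)"
  shows "\<exists>p :: rat poly. p \<noteq> 0 \<and> poly (map_poly of_rat p) x = 0"
proof -
  obtain p where p: "\<And>i. coeff p i \<in> \<int>" "p \<noteq> 0" "poly p x = 0"
    using assms by (auto simp: algebraic_def)
  define f :: "complex \<Rightarrow> rat" where "f c = (if c = 0 then 0 else (SOME r. of_rat r = c))" for c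
  have f: "of_rat (f c) = c" if "c \<in> \<int>" for c
  proof -
    have "\<exists>r. of_rat r = c" using that by (auto elim!: Ints_cases intro: exI[of _ "of_int _"])
    thus ?thesis by (auto simp: f_def intro: someI_ex)
  qed
  have "map_poly of_rat (map_poly f p) = p"
    by (intro poly_eqI) (simp add: coeff_map_poly f_def[of 0] f p)
  with p show ?thesis by (metis map_poly_of_rat_eq_0_iff)
qed

lemma rat_min_poly_ex1:
  assumes "algebraic (x :: complex)"
  shows "\<exists>!p :: rat poly. lead_coeff p = 1 \<and> irreducible p \<and> poly (map_poly of_rat p) x = 0"
proof -
  let ?r = "\<lambda>p :: rat poly. poly (map_poly of_rat p) x"
  have smult: "?r (smult c p) = of_rat c * ?r p" for c p
    using map_poly_of_rat_mult[of "[:c:]" p] by (simp add: map_poly_pCons)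
  define Q where "Q = (\<lambda>p. p \<noteq> 0 \<and> ?r p = 0)"
  obtain p0 where p0: "Q p0" "\<And>q. Q q \<Longrightarrow> degree p0 \<le> degree q"
    using algebraic_rat_poly[OF assms] ex_has_least_nat[of Q _ degree] unfolding Q_def by blast
  define m where "m = smult (inverse (lead_coeff p0)) p0"
  have "p0 \<noteq> 0" using p0 by (simp add: Q_def)
  hence monic: "lead_coeff m = 1" and deg: "degree m = degree p0" by (simp_all add: m_def)
  have root: "?r m = 0" using p0 by (simp add: m_def smult Q_def)
  have nz: "m \<noteq> 0" using monic by auto
  have dvd: "m dvd q" if "?r q = 0" for q
  proof (rule ccontr)
    assume n: "\<not> m dvd q"
    have "q = q div m * m + q mod m" by simp
    hence "?r q = ?r (q div m) * ?r m + ?r (q mod m)"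
      by (metis map_poly_of_rat_add map_poly_of_rat_mult poly_add poly_mult)
    hence "Q (q mod m)" using that root n by (auto simp: Q_def dvd_eq_mod_eq_0)
    with p0(2) have "degree m \<le> degree (q mod m)" by (simp add: deg)
    moreover have "degree (q mod m) < degree m"
      using degree_mod_less[of m q] nz n by (auto simp: dvd_eq_mod_eq_0)
    ultimately show False by simp
  qed
  have nu: "\<not> is_unit m"
  proof
    assume "is_unit m"
    then obtain q where "m * q = 1" by (metis dvdE)
    hence "?r m * ?r q = 1" by (metis map_poly_of_rat_mult poly_mult map_poly_1' of_rat_1 poly_1)
    thus False using root by simp
  qed
  have irr: "irreducible m"
  proof (rule irreducibleI[OF nz nu])
    fix a b assume ab: "m = a * b"
    have "?r a * ?r b = 0" using root by (simp add: ab map_poly_of_rat_mult)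
    hence "m dvd a \<or> m dvd b" using dvd by (metis mult_eq_0_iff)
    hence "a * b dvd a * 1 \<or> a * b dvd 1 * b" by (simp only: ab mult_1_left mult_1_right)
    moreover have "a \<noteq> 0" "b \<noteq> 0" using nz ab by auto
    ultimately show "is_unit a \<or> is_unit b"
      by (metis dvd_mult_cancel_left dvd_mult_cancel_right)
  qed
  show ?thesis
  proof (rule ex1I[of _ m])
    show "lead_coeff m = 1 \<and> irreducible m \<and> ?r m = 0" using monic irr root by simp
    fix p assume p: "lead_coeff p = 1 \<and> irreducible p \<and> ?r p = 0"
    then obtain c where c: "p = m * c" using dvd by (metis dvdE)
    with p nu have "is_unit c" using irreducibleD by blast
    then obtain d where d: "c = [:d:]" by (metis is_unit_polyE)
    have "d = 1" using p c d monic by (auto split: if_splits)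
    thus "p = m" by (simp add: c d)
  qed
qed

lemma rat_min_poly:
  assumes "algebraic x"
  shows "lead_coeff (rat_min_poly x) = 1" "irreducible (rat_min_poly x)"
    "poly (map_poly of_rat (rat_min_poly x)) x = 0"
  using theI'[OF rat_min_poly_ex1[OF assms]] by (simp_all add: rat_min_poly_def)

lemma conjugates_self: "algebraic x \<Longrightarrow> x \<in> conjugates x"
  by (simp add: conjugates_def rat_min_poly)

lemma finite_conjugates:
  assumes "algebraic x"
  shows "finite (conjugates x)"
proof -
  have "rat_min_poly x \<noteq> 0" using rat_min_poly(2)[OF assms] by auto
  thus ?thesis unfolding conjugates_def
    by (intro poly_roots_finite) (simp add: map_poly_of_rat_eq_0_iff)
qed

end

theory Submission
  imports Defs "HOL-Computational_Algebra.Field_as_Ring" "Jordan_Normal_Form.Char_Poly"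
begin

text \<open>
  Suppose \<open>\<Prod>\<^sub>i (\<alpha>\<^sub>i + t)\<^bsup>k\<^sub>i\<^esup> = 1\<close> and let \<open>k\<^sub>m > 0\<close> be the exponent of largest absolute value. Where
  \<open>\<alpha>\<^sub>m + t\<close> is small (at a prime or at an embedding), all other factors are bounded away from zero and
  infinity, so the relation bounds \<open>\<alpha>\<^sub>m + t\<close> from below with a constant independent of \<open>k\<close>. At the
  primes this says that \<open>y = N / (\<alpha>\<^sub>m + t)\<close> is an algebraic integer for a fixed \<open>N\<close>; at the embeddings it
  bounds all conjugates of \<open>y\<close>. As everything is totally real, each conjugate of \<open>t\<close> is a real solution
  of one of finitely many equations \<open>\<Sum>\<^sub>i k\<^sub>i ln |a\<^sub>i + x| = 0\<close>, and by Rolle's theorem such an equation has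
  at most \<open>2n + 1\<close> solutions. So \<open>y\<close> has boundedly many conjugates, all bounded, whose product has absolute value
  at least 1. Hence no conjugate of \<open>y\<close> is close to 0, that is, no conjugate of \<open>t\<close> is large.
\<close>

section \<open>Algebraic integers form an integrally closed ring\<close>

text \<open>Makes the complex numbers a module over the integers, so that
  \<open>int_module.span B\<close> is the additive group generated by \<open>B\<close>.\<close>

interpretation int_module: Modules.module "\<lambda>(n::int) (x::complex). of_int n * x"
  by unfold_locales (simp_all add: algebra_simps)

text \<open>The determinant trick: multiplication by \<open>x\<close> acts on the generators
  \<open>B\<close> through an integer matrix, so \<open>x\<close> is an eigenvalue of that matrix
  and a root of its monic integer characteristic polynomial.\<close>

lemma algebraic_int_if_mult_closed_span:
  fixes x :: complex
  assumes fin: "finite B" and nz: "b0 \<in> B" "b0 \<noteq> 0"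
    and closed: "\<And>b. b \<in> B \<Longrightarrow> x * b \<in> int_module.span B"
  shows "algebraic_int x"
proof -
  obtain g where g: "bij_betw g {..<card B} B"
    using ex_bij_betw_nat_finite[OF fin] by (auto simp: atLeast0LessThan)
  define n where "n = card B"
  have "\<exists>u. x * b = (\<Sum>v\<in>B. of_int (u v) * v)" if "b \<in> B" for b
    using closed[OF that] int_module.span_finite[OF fin] by auto
  then obtain u :: "complex \<Rightarrow> complex \<Rightarrow> int"
    where u: "\<And>b. b \<in> B \<Longrightarrow> x * b = (\<Sum>v\<in>B. of_int (u b v) * v)"
    by metis
  define A where "A = mat n n (\<lambda>(i, j). u (g i) (g j))"
  define v where "v = vec n g"
  have A: "A \<in> carrier_mat n n" and A': "map_mat (of_int :: int \<Rightarrow> complex) A \<in> carrier_mat n n"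
    by (simp_all add: A_def)
  \<comment> \<open>The vector of all generators is the eigenvector; the generator \<open>b0\<close>
    keeps it from being zero.\<close>
  have "v \<noteq> 0\<^sub>v n"
  proof
    assume 0: "v = 0\<^sub>v n"
    obtain i where "i < n" "g i = b0"
      using nz(1) g by (metis bij_betw_imp_surj_on imageE lessThan_iff n_def)
    with 0 nz(2) show False
      by (metis index_vec index_zero_vec(1) v_def)
  qed
  moreover have "map_mat of_int A *\<^sub>v v = x \<cdot>\<^sub>v v"
  proof (rule eq_vecI)
    fix i assume "i < dim_vec (x \<cdot>\<^sub>v v)"
    hence i: "i < n" by (simp add: v_def)
    hence gi: "g i \<in> B" using g by (auto simp: n_def bij_betw_def)
    have "vec_index (map_mat of_int A *\<^sub>v v) i = (\<Sum>j<n. of_int (u (g i) (g j)) * g j)"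
      using i by (simp add: A_def v_def scalar_prod_def atLeast0LessThan row_def)
    also have "\<dots> = (\<Sum>b\<in>B. of_int (u (g i) b) * b)"
      unfolding n_def by (rule sum.reindex_bij_betw[OF g])
    finally show "vec_index (map_mat of_int A *\<^sub>v v) i = vec_index (x \<cdot>\<^sub>v v) i"
      using i u[OF gi] by (simp add: v_def)
  qed (simp add: A_def v_def)
  ultimately have "eigenvalue (map_mat (of_int :: int \<Rightarrow> complex) A) x"
    unfolding eigenvalue_def eigenvector_def using A' by (intro exI[of _ v]) (auto simp: v_def A_def)
  hence "poly (char_poly (map_mat (of_int :: int \<Rightarrow> complex) A)) x = 0"
    using eigenvalue_root_char_poly[OF A'] by simp
  moreover have "char_poly (map_mat (of_int :: int \<Rightarrow> complex) A) = map_poly (of_int :: int \<Rightarrow> complex) (char_poly A)"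
    by (rule of_int_hom.char_poly_hom[OF A])
  moreover have "lead_coeff (char_poly (map_mat (of_int :: int \<Rightarrow> complex) A)) = 1"
    using degree_monic_char_poly[OF A'] by simp
  ultimately show ?thesis
    by (intro algebraic_int.intros[of "char_poly (map_mat (of_int :: int \<Rightarrow> complex) A)"]) (auto simp: coeff_map_poly)
qed


section \<open>Subrings and division of polynomials over them\<close>

definition is_subring :: "'a::comm_ring_1 set \<Rightarrow> bool" where
  "is_subring S \<longleftrightarrow> 1 \<in> S \<and> (\<forall>x\<in>S. \<forall>y\<in>S. x - y \<in> S \<and> x * y \<in> S)"

lemma is_subringI:
  assumes "1 \<in> S" "\<And>x y. x \<in> S \<Longrightarrow> y \<in> S \<Longrightarrow> x - y \<in> S"
    "\<And>x y. x \<in> S \<Longrightarrow> y \<in> S \<Longrightarrow> x * y \<in> S"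
  shows "is_subring S"
  using assms by (simp add: is_subring_def)

context
  fixes S :: "'a::comm_ring_1 set"
  assumes S: "is_subring S"
begin

lemma subring_1: "1 \<in> S"
  and subring_diff: "x \<in> S \<Longrightarrow> y \<in> S \<Longrightarrow> x - y \<in> S"
  and subring_mult: "x \<in> S \<Longrightarrow> y \<in> S \<Longrightarrow> x * y \<in> S"
  using S by (simp_all add: is_subring_def)

lemma subring_0: "0 \<in> S"
  using subring_diff[OF subring_1 subring_1] by simp

lemma subring_uminus: "x \<in> S \<Longrightarrow> - x \<in> S"
  using subring_diff[OF subring_0, of x] by simp

lemma subring_add: "x \<in> S \<Longrightarrow> y \<in> S \<Longrightarrow> x + y \<in> S"
  using subring_diff[of x "- y"] subring_uminus[of y] by simp

lemma subring_sum: "(\<And>i. i \<in> I \<Longrightarrow> f i \<in> S) \<Longrightarrow> sum f I \<in> S"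
  by (induction I rule: infinite_finite_induct) (auto intro: subring_add subring_0)

lemma subring_prod: "(\<And>i. i \<in> I \<Longrightarrow> f i \<in> S) \<Longrightarrow> prod f I \<in> S"
  by (induction I rule: infinite_finite_induct) (auto intro: subring_mult subring_1)

lemma subring_power: "x \<in> S \<Longrightarrow> x ^ n \<in> S"
  by (induction n) (auto intro: subring_mult subring_1)

lemma subring_of_nat: "of_nat n \<in> S"
  by (induction n) (auto intro: subring_add subring_0 subring_1)

lemma subring_of_int: "of_int n \<in> S"
  by (cases n rule: int_cases2) (auto intro: subring_uminus subring_of_nat)

end

definition polys_over :: "'a::zero set \<Rightarrow> 'a poly set" where
  "polys_over S = {p. \<forall>i. coeff p i \<in> S}"

lemma is_subring_polys_over:
  assumes "is_subring S"
  shows "is_subring (polys_over S)"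
proof (rule is_subringI)
  show "1 \<in> polys_over S"
    by (auto simp: polys_over_def subring_0[OF assms] subring_1[OF assms] coeff_1)
next
  fix p q assume "p \<in> polys_over S" "q \<in> polys_over S"
  thus "p - q \<in> polys_over S" "p * q \<in> polys_over S"
    by (auto simp: polys_over_def coeff_mult
        intro!: subring_diff[OF assms] subring_sum[OF assms] subring_mult[OF assms])
qed

lemma monom_in_polys_over: "is_subring S \<Longrightarrow> c \<in> S \<Longrightarrow> monom c n \<in> polys_over S"
  by (auto simp: polys_over_def subring_0)

lemma const_in_polys_over: "is_subring S \<Longrightarrow> c \<in> S \<Longrightarrow> [:c:] \<in> polys_over S"
  using monom_in_polys_over[of S c 0] by (simp add: monom_0)

lemma smult_in_polys_over: "is_subring S \<Longrightarrow> c \<in> S \<Longrightarrow> p \<in> polys_over S \<Longrightarrow> Polynomial.smult c p \<in> polys_over S"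
  by (auto simp: polys_over_def subring_mult)

text \<open>Long division by a monic polynomial only multiplies by leading coefficients of the
  successive dividends, so quotient and remainder keep their coefficients in
  \<open>S\<close>.\<close>

lemma polys_over_division:
  fixes m :: "'a::comm_ring_1 poly"
  assumes S: "is_subring S" and m: "m \<in> polys_over S" "lead_coeff m = 1" and p: "p \<in> polys_over S"
  shows "\<exists>q\<in>polys_over S. \<exists>r\<in>polys_over S. p = q * m + r \<and> (r = 0 \<or> degree r < degree m)"
  using p
proof (induction "degree p" arbitrary: p rule: less_induct)
  case (less p)
  note P = is_subring_polys_over[OF S]
  show ?case
  proof (cases "p = 0 \<or> degree p < degree m")
    case True
    thus ?thesis
      using less.prems subring_0[OF P] by (intro bexI[of _ 0] bexI[of _ p]) auto
  next
    case False
    hence p0: "p \<noteq> 0" and deg: "degree m \<le> degree p" by auto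
    define u where "u = monom (lead_coeff p) (degree p - degree m)"
    have u: "u \<in> polys_over S"
      using less.prems unfolding u_def by (intro monom_in_polys_over[OF S]) (auto simp: polys_over_def)
    define p' where "p' = p - u * m"
    have p': "p' \<in> polys_over S"
      unfolding p'_def using less.prems u m by (intro subring_diff[OF P] subring_mult[OF P])
    have coeff_u: "coeff (u * m) i = (if i < degree p - degree m then 0
        else lead_coeff p * coeff m (i - (degree p - degree m)))" for i
      by (simp add: u_def coeff_monom_mult)
    \<comment> \<open>Subtracting \<open>u * m\<close> cancels the leading term of \<open>p\<close>,
      and nothing of higher degree appears; a non-zero \<open>p'\<close> therefore has smaller
      degree.\<close>
    have le: "coeff p' i = 0" if "i \<ge> degree p" for i
    proof (cases "i = degree p")
      case True
      thus ?thesis using m deg by (simp add: p'_def coeff_u)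
    next
      case False
      with that deg have "i > degree p" "i - (degree p - degree m) > degree m" by auto
      thus ?thesis by (simp add: p'_def coeff_u coeff_eq_0)
    qed
    show ?thesis
    proof (cases "p' = 0")
      case True
      thus ?thesis using u subring_0[OF P] by (intro bexI[of _ u] bexI[of _ 0]) (auto simp: p'_def)
    next
      case False
      hence "degree p' < degree p" using le by (metis leading_coeff_0_iff not_le)
      from less.hyps[OF this p'] obtain q r where qr: "q \<in> polys_over S" "r \<in> polys_over S"
        "p' = q * m + r" "r = 0 \<or> degree r < degree m" by blast
      have "p = (q + u) * m + r" using qr(3) by (simp add: p'_def algebra_simps)
      thus ?thesis using qr u by (intro bexI[of _ "q + u"] bexI[of _ r]) (auto intro: subring_add[OF P])
    qed
  qed
qed

section \<open>Adjoining elements and finitely generated rings of algebraic integers\<close>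

definition adjoin :: "'a::comm_ring_1 set \<Rightarrow> 'a \<Rightarrow> 'a set" where
  "adjoin S x = (\<lambda>p. poly p x) ` polys_over S"

lemma adjoinI: "p \<in> polys_over S \<Longrightarrow> poly p x \<in> adjoin S x"
  by (auto simp: adjoin_def)

lemma adjoin_superset: "is_subring S \<Longrightarrow> S \<subseteq> adjoin S x"
  using adjoinI[OF const_in_polys_over, of S _ x] by auto

lemma adjoin_generator: "is_subring S \<Longrightarrow> x \<in> adjoin S x"
  using adjoinI[OF monom_in_polys_over, of S 1 1 x] by (auto simp: subring_1 poly_monom)

lemma is_subring_adjoin:
  assumes "is_subring S"
  shows "is_subring (adjoin S x)"
proof -
  note P = is_subring_polys_over[OF assms]
  show ?thesis
  proof (rule is_subringI)
    show "1 \<in> adjoin S x" using adjoinI[OF subring_1[OF P], of x] by simp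
  next
    fix a b assume "a \<in> adjoin S x" "b \<in> adjoin S x"
    then obtain p q where "p \<in> polys_over S" "q \<in> polys_over S" "a = poly p x" "b = poly q x"
      by (auto simp: adjoin_def)
    thus "a - b \<in> adjoin S x" "a * b \<in> adjoin S x"
      using adjoinI[OF subring_diff[OF P], of p q x] adjoinI[OF subring_mult[OF P], of p q x] by auto
  qed
qed

text \<open>Generation is meant as an additive group, not as a ring.\<close>

definition finitely_generated :: "complex set \<Rightarrow> bool" where
  "finitely_generated S \<longleftrightarrow> (\<exists>B. finite B \<and> B \<subseteq> S \<and> S \<subseteq> int_module.span B)"

text \<open>Multiplication by \<open>x\<close> maps the ring \<open>S\<close> to itself, so the
  determinant trick applies to any finite set of generators; one of them is non-zero because
  \<open>1\<close> is in \<open>S\<close>.\<close>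

lemma algebraic_int_if_finitely_generated:
  assumes S: "is_subring S" "finitely_generated S" and x: "x \<in> S"
  shows "algebraic_int x"
proof -
  obtain B where B: "finite B" "B \<subseteq> S" "S \<subseteq> int_module.span B"
    using S(2) by (auto simp: finitely_generated_def)
  have "\<exists>b\<in>B. b \<noteq> 0"
  proof (rule ccontr)
    assume "\<not> (\<exists>b\<in>B. b \<noteq> 0)"
    hence "int_module.span B \<subseteq> {0}"
      using int_module.span_minimal[of B "{0}"] int_module.subspace_single_0 by blast
    thus False using subring_1[OF S(1)] B(3) by auto
  qed
  then obtain b0 where "b0 \<in> B" "b0 \<noteq> 0" by blast
  thus ?thesis
    using B x by (intro algebraic_int_if_mult_closed_span[of B b0]) (auto intro: subring_mult[OF S(1)])
qed

text \<open>Division by the monic \<open>p\<close> reduces every polynomial expression in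
  \<open>x\<close> to degree below \<open>degree p\<close>, so the products of the generators of
  \<open>S\<close> with these powers of \<open>x\<close> generate the larger ring.\<close>

lemma finitely_generated_adjoin:
  assumes S: "is_subring S" "finitely_generated S"
    and p: "p \<in> polys_over S" "lead_coeff p = 1" "poly p x = 0"
  shows "finitely_generated (adjoin S x)"
proof -
  obtain B where B: "finite B" "B \<subseteq> S" "S \<subseteq> int_module.span B"
    using S(2) by (auto simp: finitely_generated_def)
  define B' where "B' = (\<lambda>(b, l). b * x ^ l) ` (B \<times> {..<degree p})"
  note S' = is_subring_adjoin[OF S(1), of x]
  \<comment> \<open>For fixed \<open>l\<close>, multiplication by \<open>x ^ l\<close> is additive
    and sends the generators \<open>B\<close> into \<open>B'\<close>.\<close>
  have "s * x ^ l \<in> int_module.span B'" if l: "l < degree p" and s: "s \<in> S" for s l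
  proof -
    have "s \<in> int_module.span B" using s B by blast
    thus ?thesis
    proof (induction rule: int_module.span_induct_alt)
      case base
      thus ?case using int_module.span_zero by simp
    next
      case (step c b y)
      have "b * x ^ l \<in> int_module.span B'"
        using step l by (intro int_module.span_base) (auto simp: B'_def)
      from int_module.span_add[OF int_module.span_scale[OF this, of c] step.IH]
      show ?case by (simp add: algebra_simps)
    qed
  qed
  note mem = this
  have "adjoin S x \<subseteq> int_module.span B'"
  proof
    fix a assume "a \<in> adjoin S x"
    then obtain f where f: "f \<in> polys_over S" "a = poly f x" by (auto simp: adjoin_def)
    obtain q r where qr: "r \<in> polys_over S" "f = q * p + r" "r = 0 \<or> degree r < degree p"
      using polys_over_division[OF S(1) p(1,2) f(1)] by blast
    have "a = poly r x" using f qr p by simp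
    also have "\<dots> \<in> int_module.span B'"
    proof (cases "r = 0")
      case True
      thus ?thesis using int_module.span_zero by simp
    next
      case False
      thus ?thesis unfolding poly_altdef using qr
        by (intro int_module.span_sum mem) (auto simp: polys_over_def)
    qed
    finally show "a \<in> int_module.span B'" .
  qed
  moreover have "B' \<subseteq> adjoin S x"
    using B(2) adjoin_superset[OF S(1), of x] adjoin_generator[OF S(1), of x]
    by (auto simp: B'_def intro!: subring_mult[OF S'] subring_power[OF S'])
  ultimately show ?thesis
    using B(1) by (auto simp: finitely_generated_def B'_def intro!: exI[of _ B'])
qed

lemma is_subring_Ints: "is_subring (\<int> :: complex set)"
  by (rule is_subringI) auto

text \<open>Start from the integers and adjoin the elements of \<open>A\<close> one at a
  time.\<close>

lemma algebraic_ints_in_finitely_generated: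
  assumes "finite A" "\<And>a. a \<in> A \<Longrightarrow> algebraic_int a"
  shows "\<exists>S. is_subring S \<and> finitely_generated S \<and> A \<subseteq> S"
  using assms
proof (induction A rule: finite_induct)
  case empty
  have "(\<int> :: complex set) \<subseteq> int_module.span {1}"
  proof
    fix a :: complex assume "a \<in> \<int>"
    then obtain z where "a = of_int z" by (auto elim: Ints_cases)
    thus "a \<in> int_module.span {1}"
      using int_module.span_scale[OF int_module.span_base, of 1 "{1}" z] by simp
  qed
  hence "finitely_generated \<int>"
    by (auto simp: finitely_generated_def intro!: exI[of _ "{1}"])
  thus ?case using is_subring_Ints by blast
next
  case (insert a A)
  then obtain S where S: "is_subring S" "finitely_generated S" "A \<subseteq> S" by auto
  have "algebraic_int a" using insert by auto
  then obtain p where p: "lead_coeff p = 1" "\<forall>i. coeff p i \<in> \<int>" "poly p a = 0"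
    by (auto elim: algebraic_int.cases)
  have "p \<in> polys_over S"
    using p(2) subring_of_int[OF S(1)] by (auto simp: polys_over_def elim!: Ints_cases) (metis Ints_cases)
  thus ?case
    using finitely_generated_adjoin[OF S(1,2) _ p(1,3)] is_subring_adjoin[OF S(1), of a]
      adjoin_superset[OF S(1), of a] adjoin_generator[OF S(1), of a] S(3) by blast
qed

text \<open>The coefficients lie in a finitely generated ring, which stays finitely generated after
  adjoining \<open>x\<close>.\<close>

lemma algebraic_int_monic_root:
  fixes x :: complex
  assumes p: "lead_coeff p = 1" "poly p x = 0" "\<And>i. algebraic_int (coeff p i)"
  shows "algebraic_int x"
proof -
  obtain S where S: "is_subring S" "finitely_generated S" "coeff p ` {..degree p} \<subseteq> S"
    using algebraic_ints_in_finitely_generated[of "coeff p ` {..degree p}"] p(3) by auto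
  have "p \<in> polys_over S"
  proof -
    have "coeff p i \<in> S" for i
      using S(3) subring_0[OF S(1)] by (cases "i \<le> degree p") (auto simp: coeff_eq_0)
    thus ?thesis by (simp add: polys_over_def)
  qed
  from algebraic_int_if_finitely_generated[OF is_subring_adjoin finitely_generated_adjoin, OF S(1) S(1,2) this p(1,2)]
  show ?thesis using adjoin_generator[OF S(1)] by blast
qed

lemma is_subring_algebraic_ints: "is_subring {x :: complex. algebraic_int x}"
proof (rule is_subringI)
  fix x y :: complex assume "x \<in> Collect algebraic_int" "y \<in> Collect algebraic_int"
  then obtain S where S: "is_subring S" "finitely_generated S" "{x, y} \<subseteq> S"
    using algebraic_ints_in_finitely_generated[of "{x, y}"] by auto
  thus "x - y \<in> Collect algebraic_int" "x * y \<in> Collect algebraic_int"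
    using algebraic_int_if_finitely_generated[OF S(1,2)] subring_diff[OF S(1)] subring_mult[OF S(1)] by auto
qed auto

section \<open>Conjugation homomorphisms\<close>

definition is_subfield :: "'a::field set \<Rightarrow> bool" where
  "is_subfield F \<longleftrightarrow> is_subring F \<and> (\<forall>x\<in>F. inverse x \<in> F)"

lemma subfield_subring: "is_subfield F \<Longrightarrow> is_subring F"
  and subfield_inverse: "is_subfield F \<Longrightarrow> x \<in> F \<Longrightarrow> inverse x \<in> F"
  by (simp_all add: is_subfield_def)

lemma subfield_divide:
  assumes "is_subfield F" "x \<in> F" "y \<in> F"
  shows "x / y \<in> F"
  using subring_mult[OF subfield_subring[OF assms(1)] assms(2) subfield_inverse[OF assms(1,3)]]
  by (simp add: divide_inverse)

lemma subfield_powi: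
  assumes "is_subfield F" "x \<in> F"
  shows "x powi k \<in> F"
  using assms by (auto simp: power_int_def intro!: subring_power subfield_inverse subfield_subring)

lemma of_rat_eq_quotient:
  "of_rat r = (of_int (fst (quotient_of r)) / of_int (snd (quotient_of r)) :: 'a::field_char_0)"
proof -
  have "r = of_int (fst (quotient_of r)) / of_int (snd (quotient_of r))"
    by (rule quotient_of_div) simp
  from arg_cong[OF this, of "of_rat :: rat \<Rightarrow> 'a"] show ?thesis
    by (simp only: of_rat_divide of_rat_of_int_eq)
qed

lemma Rats_subset_subfield:
  assumes "is_subfield F"
  shows "(\<rat> :: 'a::field_char_0 set) \<subseteq> F"
proof
  fix x :: 'a assume "x \<in> \<rat>"
  then obtain r where "x = of_rat r" by (auto elim: Rats_cases)
  hence "x = of_int (fst (quotient_of r)) / of_int (snd (quotient_of r))"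
    by (simp only: of_rat_eq_quotient)
  thus "x \<in> F" using assms by (auto intro!: subfield_divide subring_of_int subfield_subring)
qed

lemma is_subfield_Rats: "is_subfield (\<rat> :: 'a::field_char_0 set)"
  by (auto simp: is_subfield_def intro!: is_subringI)

text \<open>A field homomorphism on \<open>F\<close> is encoded as a total function; its values
  outside \<open>F\<close> are arbitrary. The condition at \<open>1\<close> excludes the zero map,
  so that such a map is injective on \<open>F\<close>.\<close>

definition is_hom_on :: "'a::field set \<Rightarrow> ('a \<Rightarrow> 'a) \<Rightarrow> bool" where
  "is_hom_on F \<phi> \<longleftrightarrow> \<phi> 1 = 1 \<and>
     (\<forall>x\<in>F. \<forall>y\<in>F. \<phi> (x + y) = \<phi> x + \<phi> y \<and> \<phi> (x * y) = \<phi> x * \<phi> y)"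

context
  fixes F :: "'a::field_char_0 set" and \<phi> :: "'a \<Rightarrow> 'a"
  assumes F: "is_subfield F" and \<phi>: "is_hom_on F \<phi>"
begin

lemma hom_1: "\<phi> 1 = 1"
  and hom_add: "x \<in> F \<Longrightarrow> y \<in> F \<Longrightarrow> \<phi> (x + y) = \<phi> x + \<phi> y"
  and hom_mult: "x \<in> F \<Longrightarrow> y \<in> F \<Longrightarrow> \<phi> (x * y) = \<phi> x * \<phi> y"
  using \<phi> by (auto simp: is_hom_on_def)

lemma hom_0: "\<phi> 0 = 0"
  using hom_add[of 0 0] subring_0[OF subfield_subring[OF F]] by simp

lemma hom_uminus: "x \<in> F \<Longrightarrow> \<phi> (- x) = - \<phi> x"
  using hom_add[of x "- x"] subring_uminus[OF subfield_subring[OF F], of x] hom_0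
  by (simp add: eq_neg_iff_add_eq_0 add.commute)

lemma hom_diff: "x \<in> F \<Longrightarrow> y \<in> F \<Longrightarrow> \<phi> (x - y) = \<phi> x - \<phi> y"
  using hom_add[of x "- y"] subring_uminus[OF subfield_subring[OF F], of y] hom_uminus[of y] by simp

lemma hom_inverse:
  assumes "x \<in> F"
  shows "\<phi> (inverse x) = inverse (\<phi> x)"
proof (cases "x = 0")
  case False
  hence "\<phi> x * \<phi> (inverse x) = 1"
    using hom_mult[OF assms subfield_inverse[OF F assms]] hom_1 by simp
  thus ?thesis by (metis inverse_unique)
qed (simp add: hom_0)

lemma hom_eq_0_iff:
  assumes "x \<in> F"
  shows "\<phi> x = 0 \<longleftrightarrow> x = 0"
proof
  assume "\<phi> x = 0"
  show "x = 0"
  proof (rule ccontr)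
    assume "x \<noteq> 0"
    hence "\<phi> x * \<phi> (inverse x) = 1"
      using hom_mult[OF assms subfield_inverse[OF F assms]] hom_1 by simp
    thus False using \<open>\<phi> x = 0\<close> by simp
  qed
qed (simp add: hom_0)

lemma hom_eq_iff: "x \<in> F \<Longrightarrow> y \<in> F \<Longrightarrow> \<phi> x = \<phi> y \<longleftrightarrow> x = y"
  using hom_eq_0_iff[of "x - y"] hom_diff[of x y] subring_diff[OF subfield_subring[OF F], of x y] by simp

lemma hom_divide: "x \<in> F \<Longrightarrow> y \<in> F \<Longrightarrow> \<phi> (x / y) = \<phi> x / \<phi> y"
  using hom_mult[of x "inverse y"] hom_inverse[of y] subfield_inverse[OF F, of y]
  by (simp add: divide_inverse)

lemma hom_power: "x \<in> F \<Longrightarrow> \<phi> (x ^ n) = \<phi> x ^ n"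
  by (induction n) (simp_all add: hom_1 hom_mult subring_power[OF subfield_subring[OF F]])

lemma hom_powi: "x \<in> F \<Longrightarrow> \<phi> (x powi k) = \<phi> x powi k"
  by (simp add: power_int_def hom_power hom_inverse subfield_inverse[OF F])

lemma hom_sum: "(\<And>i. i \<in> I \<Longrightarrow> f i \<in> F) \<Longrightarrow> \<phi> (sum f I) = (\<Sum>i\<in>I. \<phi> (f i))"
  by (induction I rule: infinite_finite_induct)
     (simp_all add: hom_0 hom_add subring_sum[OF subfield_subring[OF F]])

lemma hom_prod: "(\<And>i. i \<in> I \<Longrightarrow> f i \<in> F) \<Longrightarrow> \<phi> (prod f I) = (\<Prod>i\<in>I. \<phi> (f i))"
  by (induction I rule: infinite_finite_induct)
     (simp_all add: hom_1 hom_mult subring_prod[OF subfield_subring[OF F]])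

lemma hom_of_nat: "\<phi> (of_nat n) = of_nat n"
  by (induction n)
     (simp_all add: hom_0 hom_1 hom_add subring_1[OF subfield_subring[OF F]] subring_of_nat[OF subfield_subring[OF F]])

lemma hom_of_int: "\<phi> (of_int n) = of_int n"
  by (cases n rule: int_cases2)
     (simp_all add: hom_of_nat hom_uminus subring_of_nat[OF subfield_subring[OF F]])

lemma hom_of_rat: "\<phi> (of_rat r) = of_rat r"
  unfolding of_rat_eq_quotient
  by (simp only: hom_divide hom_of_int subring_of_int[OF subfield_subring[OF F]])

lemma map_poly_hom_add:
  "p \<in> polys_over F \<Longrightarrow> q \<in> polys_over F \<Longrightarrow> map_poly \<phi> (p + q) = map_poly \<phi> p + map_poly \<phi> q"
  by (intro poly_eqI) (simp add: coeff_map_poly hom_0 polys_over_def hom_add)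

lemma map_poly_hom_mult:
  "p \<in> polys_over F \<Longrightarrow> q \<in> polys_over F \<Longrightarrow> map_poly \<phi> (p * q) = map_poly \<phi> p * map_poly \<phi> q"
  by (intro poly_eqI)
     (simp add: coeff_map_poly hom_0 polys_over_def coeff_mult hom_sum hom_mult
        subring_mult[OF subfield_subring[OF F]])

lemma degree_map_poly_hom: "p \<in> polys_over F \<Longrightarrow> degree (map_poly \<phi> p) = degree p"
  by (cases "p = 0") (auto intro!: map_poly_degree_eq simp: hom_eq_0_iff polys_over_def)

lemma hom_poly:
  assumes "p \<in> polys_over F" "x \<in> F"
  shows "\<phi> (poly p x) = poly (map_poly \<phi> p) (\<phi> x)"
  using assms
  by (simp add: poly_altdef degree_map_poly_hom hom_sum hom_mult hom_power coeff_map_poly hom_0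
        polys_over_def subring_mult[OF subfield_subring[OF F]] subring_power[OF subfield_subring[OF F]])

end

section \<open>Minimal polynomials and extension of homomorphisms\<close>

definition minimal_over :: "'a::field set \<Rightarrow> 'a \<Rightarrow> 'a poly \<Rightarrow> bool" where
  "minimal_over F x m \<longleftrightarrow> m \<in> polys_over F \<and> lead_coeff m = 1 \<and> poly m x = 0 \<and>
     (\<forall>p\<in>polys_over F. p \<noteq> 0 \<longrightarrow> poly p x = 0 \<longrightarrow> degree m \<le> degree p)"

lemma minimal_over_exists:
  assumes F: "is_subfield F" and p: "p \<in> polys_over F" "p \<noteq> 0" "poly p x = 0"
  shows "\<exists>m. minimal_over F x m"
proof -
  define Q where "Q p \<longleftrightarrow> p \<in> polys_over F \<and> p \<noteq> 0 \<and> poly p x = 0" for p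
  obtain m where m: "Q m" "\<And>q. Q q \<Longrightarrow> degree m \<le> degree q"
    using ex_has_least_nat[of Q p degree] p unfolding Q_def by blast
  have "inverse (lead_coeff m) \<in> F"
    using m(1) by (intro subfield_inverse[OF F]) (auto simp: Q_def polys_over_def)
  hence "Polynomial.smult (inverse (lead_coeff m)) m \<in> polys_over F"
    using m(1) subfield_subring[OF F] by (auto simp: Q_def intro: smult_in_polys_over)
  thus ?thesis
    using m by (intro exI[of _ "Polynomial.smult (inverse (lead_coeff m)) m"])
      (auto simp: minimal_over_def Q_def)
qed

lemma is_subfield_adjoin:
  assumes F: "is_subfield F" and m: "minimal_over F x m"
  shows "is_subfield (adjoin F x)"
proof -
  note R = subfield_subring[OF F]
  note A = is_subring_adjoin[OF R, of x]
  have mF: "m \<in> polys_over F" and m1: "lead_coeff m = 1" and mx: "poly m x = 0"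
    and mmin: "\<And>p. p \<in> polys_over F \<Longrightarrow> p \<noteq> 0 \<Longrightarrow> poly p x = 0 \<Longrightarrow> degree m \<le> degree p"
    using m by (auto simp: minimal_over_def)
  text \<open>Euclid's algorithm: dividing \<open>m\<close> by \<open>h\<close> expresses \<open>1 / h(x)\<close> through the inverse of the
    remainder at \<open>x\<close>, which has smaller degree.\<close>
  have inv: "inverse (poly h x) \<in> adjoin F x" if "h \<in> polys_over F" "poly h x \<noteq> 0" "degree h < degree m" for h
    using that
  proof (induction "degree h" arbitrary: h rule: less_induct)
    case (less h)
    have h0: "h \<noteq> 0" using less.prems by auto
    have lc: "lead_coeff h \<in> F" using less.prems by (auto simp: polys_over_def)
    \<comment> \<open>Normalising \<open>h\<close> makes it an admissible divisor for
      \<open>polys_over_division\<close>.\<close>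
    define h' where "h' = Polynomial.smult (inverse (lead_coeff h)) h"
    have h': "h' \<in> polys_over F" "lead_coeff h' = 1" "degree h' = degree h"
      using h0 smult_in_polys_over[OF R subfield_inverse[OF F lc] less.prems(1)] by (simp_all add: h'_def)
    have ph': "poly h x = lead_coeff h * poly h' x" using h0 by (simp add: h'_def)
    have lc': "inverse (lead_coeff h) \<in> adjoin F x"
      using subfield_inverse[OF F lc] adjoin_superset[OF R] by auto
    have "inverse (poly h' x) \<in> adjoin F x"
    proof (cases "degree h' = 0")
      case True
      then obtain c where "h' = [:c:]" by (rule degree_eq_zeroE)
      hence "h' = 1" using h'(2) by simp
      thus ?thesis using subring_1[OF A] by simp
    next
      case False
      obtain q r where qr: "q \<in> polys_over F" "r \<in> polys_over F" "m = q * h' + r"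
        "r = 0 \<or> degree r < degree h'"
        using polys_over_division[OF R h'(1,2) mF] by blast
      have r: "poly r x = - (poly q x * poly h' x)"
      proof -
        have "poly m x = poly q x * poly h' x + poly r x" by (subst qr(3)) simp
        thus ?thesis using mx by (simp add: eq_neg_iff_add_eq_0 add.commute)
      qed
      have q0: "q \<noteq> 0"
      proof
        assume "q = 0"
        hence "m = r" using qr(3) by simp
        moreover have "m \<noteq> 0" using m1 by auto
        ultimately show False using qr(4) less.prems(3) h'(3) by simp
      qed
      have ph'0: "poly h' x \<noteq> 0" using less.prems(2) ph' by auto
      \<comment> \<open>Otherwise the minimality of \<open>m\<close> fails: a non-zero
        \<open>r\<close> would be a smaller polynomial vanishing at \<open>x\<close>, and if
        \<open>r = 0\<close> then the proper factor \<open>q\<close> of \<open>m\<close> would be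
        one.\<close>
      have "poly r x \<noteq> 0"
      proof
        assume "poly r x = 0"
        show False
        proof (cases "r = 0")
          case True
          hence "poly q x = 0" using r ph'0 by simp
          hence "degree m \<le> degree q" by (intro mmin qr(1) q0)
          moreover have "degree m = degree q + degree h'"
          proof -
            have "h' \<noteq> 0" using h'(2) by auto
            thus ?thesis using True qr(3) degree_mult_eq[OF q0, of h'] by simp
          qed
          ultimately show False using False by simp
        next
          case r0: False
          hence "degree m \<le> degree r" by (intro mmin qr(2) \<open>poly r x = 0\<close>)
          thus False using qr(4) r0 h'(3) less.prems(3) by simp
        qed
      qed
      hence "r \<noteq> 0" by auto
      hence "inverse (poly r x) \<in> adjoin F x"
        using qr(2,4) h'(3) less.prems(3) \<open>poly r x \<noteq> 0\<close> by (intro less.hyps) simp_all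
      moreover have "inverse (poly h' x) = - (poly q x * inverse (poly r x))"
        using \<open>poly r x \<noteq> 0\<close> ph'0 by (simp add: r)
      ultimately show ?thesis
        using adjoinI[OF qr(1), of x] by (auto intro!: subring_uminus[OF A] subring_mult[OF A])
    qed
    thus ?case unfolding ph' inverse_mult_distrib by (intro subring_mult[OF A] lc')
  qed
  have "inverse a \<in> adjoin F x" if a: "a \<in> adjoin F x" for a
  proof (cases "a = 0")
    case False
    obtain f where f: "f \<in> polys_over F" "a = poly f x" using a by (auto simp: adjoin_def)
    obtain q r where qr: "r \<in> polys_over F" "f = q * m + r" "r = 0 \<or> degree r < degree m"
      using polys_over_division[OF R mF m1 f(1)] by blast
    have a: "a = poly r x" using qr(2) f(2) mx by simp
    hence "r \<noteq> 0" using False by auto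
    thus ?thesis using inv[of r] qr(1,3) False a by simp
  qed (use a in auto)
  thus ?thesis using A by (simp add: is_subfield_def)
qed

text \<open>The extension must send \<open>poly p x\<close> to
  \<open>poly (map_poly \<phi> p) x'\<close>. This is well defined because every polynomial over
  \<open>F\<close> vanishing at \<open>x\<close> is a multiple of \<open>m\<close>.\<close>

lemma hom_extend:
  fixes x x' :: "'a::field_char_0"
  assumes F: "is_subfield F" and \<phi>: "is_hom_on F \<phi>" and m: "minimal_over F x m"
    and x': "poly (map_poly \<phi> m) x' = 0"
  shows "\<exists>\<psi>. is_hom_on (adjoin F x) \<psi> \<and> (\<forall>a\<in>F. \<psi> a = \<phi> a) \<and> \<psi> x = x'"
proof -
  note R = subfield_subring[OF F]
  note P = is_subring_polys_over[OF R]
  have mF: "m \<in> polys_over F" and m1: "lead_coeff m = 1" and mx: "poly m x = 0"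
    and mmin: "\<And>p. p \<in> polys_over F \<Longrightarrow> p \<noteq> 0 \<Longrightarrow> poly p x = 0 \<Longrightarrow> degree m \<le> degree p"
    using m by (auto simp: minimal_over_def)
  note h0 = hom_0[OF F \<phi>] and hadd = map_poly_hom_add[OF F \<phi>] and hmult = map_poly_hom_mult[OF F \<phi>]
  have zero: "poly (map_poly \<phi> p) x' = 0" if p: "p \<in> polys_over F" "poly p x = 0" for p
  proof -
    obtain q r where qr: "q \<in> polys_over F" "r \<in> polys_over F" "p = q * m + r" "r = 0 \<or> degree r < degree m"
      using polys_over_division[OF R mF m1 p(1)] by blast
    have "poly r x = 0" using p(2) mx qr(3) by simp
    hence "r = 0" using qr(2,4) mmin[of r] by (cases "r = 0") auto
    thus ?thesis using qr(1,3) hmult[of q m] mF x' by simp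
  qed
  \<comment> \<open>An arbitrary representing polynomial is chosen; the next fact shows that the
    value does not depend on the choice.\<close>
  define \<psi> where "\<psi> a = poly (map_poly \<phi> (SOME p. p \<in> polys_over F \<and> poly p x = a)) x'" for a
  have \<psi>: "\<psi> (poly p x) = poly (map_poly \<phi> p) x'" if p: "p \<in> polys_over F" for p
  proof -
    define q where "q = (SOME q. q \<in> polys_over F \<and> poly q x = poly p x)"
    have q: "q \<in> polys_over F \<and> poly q x = poly p x"
      unfolding q_def by (rule someI[of _ p]) (use p in auto)
    have d: "p - q \<in> polys_over F" using p q by (auto intro: subring_diff[OF P])
    hence "poly (map_poly \<phi> (p - q)) x' = 0" using q by (intro zero) auto
    moreover have "map_poly \<phi> p = map_poly \<phi> (p - q) + map_poly \<phi> q"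
      using hadd[OF d, of q] q by simp
    ultimately show ?thesis by (simp add: \<psi>_def q_def)
  qed
  have c: "\<psi> a = \<phi> a" if "a \<in> F" for a
  proof -
    have "map_poly \<phi> [:a:] = [:\<phi> a:]"
      by (intro poly_eqI) (simp add: coeff_map_poly h0 coeff_pCons split: nat.split)
    thus ?thesis using \<psi>[OF const_in_polys_over[OF R that]] by simp
  qed
  have "\<psi> x = x'"
    using \<psi>[OF monom_in_polys_over[OF R subring_1[OF R], of 1]]
    by (simp add: poly_monom map_poly_monom h0 hom_1[OF F \<phi>])
  moreover have "is_hom_on (adjoin F x) \<psi>"
    unfolding is_hom_on_def
  proof (intro conjI ballI)
    show "\<psi> 1 = 1" using c[OF subring_1[OF R]] hom_1[OF F \<phi>] by simp
  next
    fix a b assume "a \<in> adjoin F x" "b \<in> adjoin F x"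
    then obtain p q where pq: "p \<in> polys_over F" "q \<in> polys_over F" "a = poly p x" "b = poly q x"
      by (auto simp: adjoin_def)
    show "\<psi> (a + b) = \<psi> a + \<psi> b"
      using \<psi>[OF subring_add[OF P pq(1,2)]] \<psi>[OF pq(1)] \<psi>[OF pq(2)] pq by (simp add: hadd)
    show "\<psi> (a * b) = \<psi> a * \<psi> b"
      using \<psi>[OF subring_mult[OF P pq(1,2)]] \<psi>[OF pq(1)] \<psi>[OF pq(2)] pq by (simp add: hmult)
  qed
  ultimately show ?thesis using c by blast
qed

text \<open>The image of the minimal polynomial of \<open>x\<close> under \<open>\<phi>\<close> is
  not constant, so it has a complex root to which \<open>x\<close> can be sent.\<close>

lemma hom_extend_algebraic:
  fixes x :: complex
  assumes F: "is_subfield F" and \<phi>: "is_hom_on F \<phi>" and x: "algebraic x"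
  shows "\<exists>F' \<psi>. is_subfield F' \<and> is_hom_on F' \<psi> \<and> F \<subseteq> F' \<and> x \<in> F' \<and> (\<forall>a\<in>F. \<psi> a = \<phi> a)"
proof -
  obtain p where p: "\<And>i. coeff p i \<in> \<rat>" "p \<noteq> 0" "poly p x = 0"
    using x by (auto simp: algebraic_altdef)
  have "p \<in> polys_over F" using p(1) Rats_subset_subfield[OF F] by (auto simp: polys_over_def)
  then obtain m where m: "minimal_over F x m"
    using minimal_over_exists[OF F _ p(2,3)] by blast
  have mF: "m \<in> polys_over F" and m1: "lead_coeff m = 1" and mx: "poly m x = 0"
    and mmin: "\<And>p. p \<in> polys_over F \<Longrightarrow> p \<noteq> 0 \<Longrightarrow> poly p x = 0 \<Longrightarrow> degree m \<le> degree p"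
    using m by (auto simp: minimal_over_def)
  have "degree m \<noteq> 0"
  proof
    assume "degree m = 0"
    then obtain c where "m = [:c:]" by (metis degree_eq_zeroE)
    thus False using m1 mx by auto
  qed
  hence "degree (map_poly \<phi> m) \<noteq> 0" using degree_map_poly_hom[OF F \<phi> mF] by simp
  hence "\<not> constant (poly (map_poly \<phi> m))" by (simp add: constant_degree)
  then obtain x' where "poly (map_poly \<phi> m) x' = 0" using fundamental_theorem_of_algebra by blast
  from hom_extend[OF F \<phi> m this] show ?thesis
    using is_subfield_adjoin[OF F m] adjoin_superset[OF subfield_subring[OF F]]
      adjoin_generator[OF subfield_subring[OF F]] by blast
qed

section \<open>Conjugates over the rationals as images under homomorphisms\<close>

lemma rat_min_poly_coprime:
  assumes x: "algebraic x" and q: "\<not> rat_min_poly x dvd q"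
  obtains a b where "a * rat_min_poly x + b * q = 1"
proof -
  have "coprime (rat_min_poly x) q"
    using rat_min_poly(2)[OF x] q by (intro prime_elem_imp_coprime irreducible_imp_prime_elem_gcd)
  thus ?thesis using that bezout_coefficients_fst_snd[of "rat_min_poly x" q] by (metis coprime_iff_gcd_eq_1)
qed

lemma rat_min_poly_dvd:
  assumes x: "algebraic x" and q: "poly (map_poly of_rat q) x = 0"
  shows "rat_min_poly x dvd q"
proof (rule ccontr)
  assume "\<not> rat_min_poly x dvd q"
  then obtain a b where "a * rat_min_poly x + b * q = 1" by (rule rat_min_poly_coprime[OF x])
  hence "map_poly (of_rat :: rat \<Rightarrow> complex) (a * rat_min_poly x + b * q) = 1" by simp
  hence "poly (map_poly of_rat (a * rat_min_poly x + b * q)) x = 1" by simp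
  thus False using q rat_min_poly(3)[OF x] by (simp add: map_poly_of_rat_mult map_poly_of_rat_add)
qed

lemma minimal_over_Rats:
  assumes x: "algebraic x"
  shows "minimal_over \<rat> x (map_poly of_rat (rat_min_poly x))"
proof -
  have deg: "degree (map_poly (of_rat :: rat \<Rightarrow> complex) p) = degree p" for p
    by (rule degree_map_poly) simp
  have "degree (rat_min_poly x) \<le> degree p"
    if p: "p \<in> polys_over \<rat>" "p \<noteq> 0" "poly p x = 0" for p
  proof -
    have "\<forall>i. \<exists>r. coeff p i = of_rat r" using p(1) by (auto simp: polys_over_def elim: Rats_cases)
    then obtain f where f: "\<And>i. coeff p i = of_rat (f i)" by metis
    \<comment> \<open>Pulls \<open>p\<close> back to a polynomial over the type of rationals, where
      divisibility by \<open>rat_min_poly x\<close> is available.\<close>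
    define p' where "p' = Abs_poly f"
    have "eventually (\<lambda>i. f i = 0) cofinite"
      using MOST_coeff_eq_0[of p] f by (simp add: cofinite_eq_sequentially)
    hence "coeff p' = f" unfolding p'_def by (intro Abs_poly_inverse) simp
    hence p': "map_poly of_rat p' = p" by (intro poly_eqI) (simp add: coeff_map_poly f)
    have "rat_min_poly x dvd p'" using rat_min_poly_dvd[OF x] p p' by simp
    moreover have "p' \<noteq> 0" using p p' by auto
    ultimately show ?thesis using dvd_imp_degree_le[of _ p'] deg[of p'] p' by simp
  qed
  thus ?thesis
    using rat_min_poly[OF x]
    by (auto simp: minimal_over_def polys_over_def coeff_map_poly deg)
qed

text \<open>A homomorphism fixes the rationals, so it permutes no coefficients of
  \<open>rat_min_poly x\<close> and sends its root \<open>x\<close> to another root.\<close>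

lemma hom_conjugate:
  assumes F: "is_subfield F" "is_hom_on F \<phi>" and x: "algebraic x" "x \<in> F"
  shows "\<phi> x \<in> conjugates x"
proof -
  have "map_poly of_rat p \<in> polys_over F" for p :: "rat poly"
    using Rats_subset_subfield[OF F(1)] by (auto simp: polys_over_def coeff_map_poly)
  moreover have "map_poly \<phi> (map_poly of_rat p) = map_poly of_rat p" for p :: "rat poly"
    by (intro poly_eqI) (simp add: coeff_map_poly hom_0[OF F] hom_of_rat[OF F])
  ultimately show ?thesis
    using hom_poly[OF F _ x(2), of "map_poly of_rat (rat_min_poly x)"] rat_min_poly(3)[OF x(1)] hom_0[OF F]
    by (simp add: conjugates_def)
qed

text \<open>Converse of \<open>hom_conjugate\<close>: send \<open>x\<close> to \<open>x'\<close>
  over the rationals, then adjoin the elements of \<open>A\<close> one by one. The set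
  \<open>A\<close> allows a conjugate of one number to be followed through expressions in several
  others.\<close>

lemma conjugate_hom:
  assumes x: "algebraic x" and x': "x' \<in> conjugates x" and A: "finite A" "\<And>a. a \<in> A \<Longrightarrow> algebraic a"
  obtains F \<phi> where "is_subfield F" "is_hom_on F \<phi>" "x \<in> F" "\<phi> x = x'" "A \<subseteq> F"
proof -
  let ?m = "map_poly of_rat (rat_min_poly x)"
  have id: "is_hom_on \<rat> (\<lambda>x :: complex. x)" by (simp add: is_hom_on_def)
  have "\<exists>\<psi>. is_hom_on (adjoin \<rat> x) \<psi> \<and> (\<forall>a\<in>\<rat>. \<psi> a = a) \<and> \<psi> x = x'"
    using x' by (intro hom_extend[OF is_subfield_Rats id minimal_over_Rats[OF x]]) (simp add: conjugates_def)
  then obtain \<psi>0 where \<psi>0: "is_hom_on (adjoin \<rat> x) \<psi>0" "\<psi>0 x = x'" by blast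
  have "\<exists>F \<phi>. is_subfield F \<and> is_hom_on F \<phi> \<and> x \<in> F \<and> \<phi> x = x' \<and> A \<subseteq> F"
    using A
  proof (induction A rule: finite_induct)
    case empty
    show ?case
      using \<psi>0 is_subfield_adjoin[OF is_subfield_Rats minimal_over_Rats[OF x]]
        adjoin_generator[OF subfield_subring[OF is_subfield_Rats]] by blast
  next
    case (insert a A)
    then obtain F \<phi> where F: "is_subfield F" "is_hom_on F \<phi>" "x \<in> F" "\<phi> x = x'" "A \<subseteq> F" by auto
    obtain F' \<psi> where "is_subfield F'" "is_hom_on F' \<psi>" "F \<subseteq> F'" "a \<in> F'" "\<forall>a\<in>F. \<psi> a = \<phi> a"
      using hom_extend_algebraic[OF F(1,2), of a] insert.prems by auto
    with F show ?case by (intro exI[of _ F'] exI[of _ \<psi>]) auto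
  qed
  thus ?thesis using that by blast
qed

text \<open>Up to sign, the product of the conjugates is the constant coefficient of the minimal
  polynomial. It is a non-zero rational algebraic integer, hence a non-zero integer.\<close>

lemma prod_norm_conjugates_ge_1:
  assumes y: "algebraic_int y" "y \<noteq> 0"
  shows "1 \<le> (\<Prod>z\<in>conjugates y. norm z)"
proof -
  have alg: "algebraic y" using y by auto
  define m where "m = rat_min_poly y"
  define P where "P = map_poly (of_rat :: rat \<Rightarrow> complex) m"
  have deg: "degree P = degree m" unfolding P_def by (rule degree_map_poly) simp
  have lc: "lead_coeff P = 1" using rat_min_poly(1)[OF alg] by (simp add: P_def m_def[symmetric] deg[unfolded P_def] coeff_map_poly)
  have "degree m \<noteq> 0" using rat_min_poly(2)[OF alg]
    by (metis irreducible_def is_unit_iff_degree m_def)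
  \<comment> \<open>Coprimality with the derivative makes all roots simple, so the product over the
    set \<open>conjugates y\<close> misses no multiplicity.\<close>
  hence "\<not> m dvd pderiv m" by simp
  then obtain a b where ab: "a * m + b * pderiv m = 1"
    using rat_min_poly_coprime[OF alg, of "pderiv m"] unfolding m_def by blast
  have pd: "pderiv P = map_poly of_rat (pderiv m)"
    unfolding P_def by (intro poly_eqI) (simp add: coeff_map_poly coeff_pderiv of_rat_mult of_rat_add)
  have "\<not> (poly P z = 0 \<and> poly (pderiv P) z = 0)" for z
  proof
    assume z: "poly P z = 0 \<and> poly (pderiv P) z = 0"
    have "poly (map_poly of_rat (a * m + b * pderiv m)) z = 1" by (simp add: ab)
    thus False using z[unfolded pd, unfolded P_def] by (simp add: map_poly_of_rat_mult map_poly_of_rat_add)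
  qed
  hence "rsquarefree P" by (simp add: rsquarefree_roots)
  hence "P = (\<Prod>z\<in>conjugates y. [:-z, 1:])"
    using complex_poly_decompose_rsquarefree[of P] lc by (simp add: conjugates_def P_def m_def)
  hence P0: "poly P 0 = (\<Prod>z\<in>conjugates y. - z)" by (simp add: poly_prod)
  \<comment> \<open>A conjugate is a root of the same monic integer polynomial as \<open>y\<close>,
    and injectivity of the homomorphism keeps it non-zero.\<close>
  have conj: "algebraic_int z \<and> z \<noteq> 0" if z: "z \<in> conjugates y" for z
  proof -
    obtain F \<phi> where F: "is_subfield F" "is_hom_on F \<phi>" "y \<in> F" "\<phi> y = z"
      using conjugate_hom[OF alg z, of "{}"] by auto
    obtain p where p: "lead_coeff p = 1" "\<forall>i. coeff p i \<in> \<int>" "poly p y = 0"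
      using y(1) by (auto elim: algebraic_int.cases)
    have "p \<in> polys_over F"
      using p(2) Rats_subset_subfield[OF F(1)] Ints_subset_Rats by (auto simp: polys_over_def)
    moreover have "map_poly \<phi> p = p"
    proof (rule poly_eqI)
      fix i
      obtain n where "coeff p i = of_int n" using p(2) by (metis Ints_cases)
      thus "coeff (map_poly \<phi> p) i = coeff p i"
        by (simp add: coeff_map_poly hom_0[OF F(1,2)] hom_of_int[OF F(1,2)])
    qed
    ultimately have "poly p z = 0" using hom_poly[OF F(1,2) _ F(3), of p] p F(4) hom_0[OF F(1,2)] by simp
    thus ?thesis using p y F hom_eq_0_iff[OF F(1-3)] by (auto intro: algebraic_int.intros)
  qed
  have "poly P 0 \<in> \<rat>" by (simp add: poly_0_coeff_0 P_def coeff_map_poly)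
  moreover have "algebraic_int (poly P 0)"
    unfolding P0 using subring_prod[OF is_subring_algebraic_ints, of "conjugates y" uminus] conj by auto
  ultimately have "poly P 0 \<in> \<int>" using rational_algebraic_int_is_int by blast
  moreover have "poly P 0 \<noteq> 0" unfolding P0 using conj finite_conjugates[OF alg] by auto
  ultimately have "1 \<le> norm (poly P 0)" by (auto elim!: Ints_cases)
  also have "\<dots> = (\<Prod>z\<in>conjugates y. norm z)" by (simp add: P0 prod_norm[symmetric])
  finally show ?thesis .
qed

section \<open>Multiplicative relations between translates\<close>

lemma card_le_if_separated:
  fixes R Z :: "real set"
  assumes Z: "finite Z" and sep: "\<And>x y. x \<in> R \<Longrightarrow> y \<in> R \<Longrightarrow> x < y \<Longrightarrow> \<exists>z\<in>Z. x \<le> z \<and> z < y"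
  shows "finite R \<and> card R \<le> card Z + 1"
proof -
  \<comment> \<open>Counting the points of \<open>Z\<close> below \<open>x\<close> is strictly
    increasing on \<open>R\<close> and takes values in \<open>{0..card Z}\<close>, which explains
    the extra 1.\<close>
  define f where "f x = card {z\<in>Z. z < x}" for x
  have mono: "f x < f y" if xy: "x \<in> R" "y \<in> R" "x < y" for x y
  proof -
    obtain z where "z \<in> Z" "x \<le> z" "z < y" using sep[OF xy] by (elim bexE conjE)
    hence "z \<notin> {z\<in>Z. z < x}" "z \<in> {z\<in>Z. z < y}" "{z\<in>Z. z < x} \<subseteq> {z\<in>Z. z < y}"
      using xy(3) by simp_all (use xy(3) in force)
    hence "{z\<in>Z. z < x} \<subset> {z\<in>Z. z < y}" by blast
    thus ?thesis unfolding f_def using Z by (intro psubset_card_mono) auto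
  qed
  have inj: "inj_on f R"
  proof (rule inj_onI)
    fix x y assume "x \<in> R" "y \<in> R" "f x = f y"
    thus "x = y" using mono[of x y] mono[of y x] by (cases x y rule: linorder_cases) auto
  qed
  moreover have sub: "f ` R \<subseteq> {..card Z}" using Z by (auto simp: f_def intro!: card_mono)
  ultimately show ?thesis
    using card_inj_on_le[OF inj sub] finite_imageD[OF finite_subset[OF sub] inj] by auto
qed

lemma ln_power_int_pos:
  assumes "(x::real) > 0"
  shows "ln (x powi k) = of_int k * ln x"
  using assms by (simp add: power_int_def ln_realpow ln_inverse power_inverse)

lemma has_real_derivative_ln_square:
  assumes "a + x \<noteq> (0::real)"
  shows "((\<lambda>x. ln ((a + x)\<^sup>2)) has_real_derivative 2 / (a + x)) (at x)"
proof -
  have "((\<lambda>x. (a + x)\<^sup>2) has_real_derivative 2 * (a + x)) (at x)"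
    by (auto intro!: derivative_eq_intros)
  from DERIV_chain2[OF DERIV_ln this]
  have "((\<lambda>x. ln ((a + x)\<^sup>2)) has_real_derivative inverse ((a + x)\<^sup>2) * (2 * (a + x))) (at x)"
    using assms by simp
  also have "inverse ((a + x)\<^sup>2) * (2 * (a + x)) = 2 / (a + x)"
    using assms by (simp add: power2_eq_square divide_simps)
  finally show ?thesis .
qed

text \<open>Two solutions are separated by some zero \<open>- a i\<close> of a factor or, by Rolle's
  theorem, by a critical point of the logarithm of the product. There are at most
  \<open>card I\<close> points of each kind, whatever the exponents are.\<close>

lemma real_relation_solutions:
  fixes a :: "'i \<Rightarrow> real" and k :: "'i \<Rightarrow> int"
  assumes I: "finite I" and inj: "inj_on a I" and i0: "i0 \<in> I" "k i0 \<noteq> 0"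
  defines "R \<equiv> {x. (\<forall>i\<in>I. a i + x \<noteq> 0) \<and> (\<Prod>i\<in>I. (a i + x) powi k i) = 1}"
  shows "finite R \<and> card R \<le> 2 * card I + 1"
proof -
  \<comment> \<open>The numerator of the logarithmic derivative, the sum of
    \<open>k i / (a i + x)\<close>, over the common denominator.\<close>
  define P where "P = (\<Sum>i\<in>I. Polynomial.smult (of_int (k i)) (\<Prod>j\<in>I - {i}. [:a j, 1:]))"
  have polyP: "poly P x = (\<Sum>i\<in>I. of_int (k i) * (\<Prod>j\<in>I - {i}. a j + x))" for x
    by (simp add: P_def poly_sum poly_prod)
  \<comment> \<open>At \<open>- a i0\<close> all summands but one vanish, and the remaining one is
    non-zero since the \<open>a i\<close> are distinct; so \<open>P\<close> is not the zero
    polynomial.\<close>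
  have "poly P (- a i0) = of_int (k i0) * (\<Prod>j\<in>I - {i0}. a j - a i0)"
  proof -
    have "(\<Prod>j\<in>I - {i}. a j + (- a i0)) = 0" if "i \<in> I - {i0}" for i
      using that I i0 by (intro prod_zero) (auto intro!: bexI[of _ i0])
    hence "(\<Sum>i\<in>I - {i0}. of_int (k i) * (\<Prod>j\<in>I - {i}. a j + (- a i0))) = 0"
      by (intro sum.neutral) auto
    thus ?thesis unfolding polyP using I i0 by (subst sum.remove[of I i0]) auto
  qed
  also have "\<dots> \<noteq> 0" using I i0 inj by (auto simp: inj_on_def)
  finally have P0: "P \<noteq> 0" by auto
  have degP: "degree P \<le> card I"
    unfolding P_def
  proof (intro degree_sum_le I)
    fix i assume "i \<in> I"
    have "degree (\<Prod>j\<in>I - {i}. [:a j, 1:]) = (\<Sum>j\<in>I - {i}. degree [:a j, 1:])"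
      by (rule degree_prod_eq_sum_degree) auto
    also have "\<dots> \<le> card I" using I by (simp add: card_Diff_singleton_if)
    finally show "degree (Polynomial.smult (of_int (k i)) (\<Prod>j\<in>I - {i}. [:a j, 1:])) \<le> card I"
      using degree_smult_le order.trans by blast
  qed
  define Z where "Z = (\<lambda>i. - a i) ` I \<union> {x. poly P x = 0}"
  have fin: "finite {x. poly P x = 0}" using P0 by (rule poly_roots_finite)
  have "card Z \<le> card ((\<lambda>i. - a i) ` I) + card {x. poly P x = 0}"
    unfolding Z_def by (rule card_Un_le)
  also have "card {x. poly P x = 0} \<le> card I" using card_poly_roots_bound[OF P0] degP by simp
  also have "card ((\<lambda>i. - a i) ` I) \<le> card I" by (rule card_image_le[OF I])
  finally have cardZ: "card Z \<le> 2 * card I" by simp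
  have sep: "\<exists>z\<in>Z. x \<le> z \<and> z < y" if xy: "x \<in> R" "y \<in> R" "x < y" for x y
  proof (cases "\<exists>i\<in>I. x \<le> - a i \<and> - a i \<le> y")
    case True
    thus ?thesis using xy by (force simp: R_def Z_def)
  next
    case False
    \<comment> \<open>The squares serve as absolute values: they make the logarithm differentiable
      on both sides of each \<open>- a i\<close>.\<close>
    define g where "g x = (\<Sum>i\<in>I. of_int (k i) * ln ((a i + x)\<^sup>2))" for x
    define g' where "g' x = (\<Sum>i\<in>I. of_int (k i) * (2 / (a i + x)))" for x
    have gR: "g u = 0" if u: "u \<in> R" for u
    proof -
      have nz: "a i + u \<noteq> 0" if "i \<in> I" for i using u that by (auto simp: R_def)
      have "g u = (\<Sum>i\<in>I. ln ((a i + u)\<^sup>2 powi k i))"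
        unfolding g_def by (intro sum.cong) (auto simp: ln_power_int_pos nz)
      also have "\<dots> = ln (\<Prod>i\<in>I. (a i + u)\<^sup>2 powi k i)"
        by (rule ln_prod[symmetric]) (auto simp: I nz)
      also have "(\<Prod>i\<in>I. (a i + u)\<^sup>2 powi k i) = (\<Prod>i\<in>I. (a i + u) powi k i)\<^sup>2"
        by (simp add: power2_eq_square power_int_mult_distrib prod.distrib)
      also have "\<dots> = 1" using u by (simp add: R_def)
      finally show ?thesis by simp
    qed
    have deriv: "(g has_real_derivative g' u) (at u)" if "x \<le> u" "u \<le> y" for u
    proof -
      have nz: "a i + u \<noteq> 0" if "i \<in> I" for i
        using False that \<open>x \<le> u\<close> \<open>u \<le> y\<close> by (metis add.commute eq_neg_iff_add_eq_0)
      show ?thesis unfolding g_def g'_def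
        by (rule DERIV_sum, rule DERIV_cmult, rule has_real_derivative_ln_square) (rule nz)
    qed
    obtain z where z: "x < z" "z < y" "g' z = 0"
    proof -
      have "\<exists>z. x < z \<and> z < y \<and> DERIV g z :> 0"
      proof (rule Rolle[OF xy(3)])
        show "g x = g y" using gR xy by simp
        show "continuous_on {x..y} g"
          by (intro DERIV_continuous_on[of _ _ g']) (auto intro: DERIV_subset deriv)
        show "g differentiable (at u)" if "x < u" "u < y" for u
          using deriv[of u] that by (auto simp: real_differentiable_def)
      qed
      then obtain z where "x < z" "z < y" "DERIV g z :> 0" by blast
      thus ?thesis using that[of z] deriv[of z] DERIV_unique by force
    qed
    have nz: "a i + z \<noteq> 0" if "i \<in> I" for i
      using False that z by (metis add.commute eq_neg_iff_add_eq_0 less_imp_le)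
    \<comment> \<open>Clearing denominators in \<open>g' z = 0\<close> shows that \<open>z\<close>
      is a root of \<open>P\<close>.\<close>
    have "2 * poly P z = g' z * (\<Prod>j\<in>I. a j + z)"
      unfolding polyP g'_def sum_distrib_left sum_distrib_right
      using nz I by (intro sum.cong) (auto simp: prod.remove[of I _ "\<lambda>j. a j + z"])
    hence "z \<in> Z" using z by (simp add: Z_def)
    thus ?thesis using z by (intro bexI[of _ z]) auto
  qed
  have "finite Z" using fin I by (simp add: Z_def)
  hence "finite R \<and> card R \<le> card Z + 1" using sep by (rule card_le_if_separated)
  thus ?thesis using cardZ by simp
qed

section \<open>Lower bounds for one factor: absolute values and integrality\<close>

text \<open>Since \<open>k i0\<close> is the largest exponent, every other factor contributes at
  most \<open>W\<close> to the power \<open>k i0\<close>. Taking the root of order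
  \<open>k i0\<close> removes the exponents from the bound.\<close>

lemma prod_powi_eq_1_lower_bound:
  fixes z :: "'i \<Rightarrow> complex"
  assumes I: "finite I" "i0 \<in> I" and K: "k i0 > 0" "\<And>j. j \<in> I \<Longrightarrow> \<bar>k j\<bar> \<le> k i0"
    and rel: "(\<Prod>j\<in>I. z j powi k j) = 1" and W: "W \<ge> 1"
    and bd: "\<And>j. j \<in> I - {i0} \<Longrightarrow> 1 / W \<le> norm (z j) \<and> norm (z j) \<le> W"
  shows "1 / W ^ card I \<le> norm (z i0)"
proof -
  define K where "K = nat (k i0)"
  have K0: "K > 0" "k i0 = int K" using K by (auto simp: K_def)
  have each: "norm (z j) powi k j \<le> W ^ K" if j: "j \<in> I - {i0}" for j
  proof (cases "k j \<ge> 0")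
    case True
    hence "norm (z j) powi k j = norm (z j) ^ nat (k j)" by (simp add: power_int_def)
    also have "\<dots> \<le> W ^ nat (k j)" using bd[OF j] by (intro power_mono) auto
    also have "\<dots> \<le> W ^ K" using K(2)[of j] j W by (intro power_increasing) (auto simp: K_def)
    finally show ?thesis .
  next
    case False
    hence "norm (z j) powi k j = inverse (norm (z j)) ^ nat (- k j)" by (simp add: power_int_def)
    also have "inverse (norm (z j)) \<le> W"
    proof -
      have "0 < 1 / W" "1 / W \<le> norm (z j)" using bd[OF j] W by auto
      hence "inverse (norm (z j)) \<le> inverse (1 / W)" by (intro le_imp_inverse_le)
      thus ?thesis by simp
    qed
    hence "inverse (norm (z j)) ^ nat (- k j) \<le> W ^ nat (- k j)" by (intro power_mono) auto
    also have "\<dots> \<le> W ^ K" using K(2)[of j] j W by (intro power_increasing) (auto simp: K_def)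
    finally show ?thesis .
  qed
  have "1 = norm (\<Prod>j\<in>I. z j powi k j)" by (simp add: rel)
  also have "\<dots> = norm (z i0) ^ K * (\<Prod>j\<in>I - {i0}. norm (z j) powi k j)"
    using I by (simp add: prod_norm[symmetric] norm_power_int prod.remove[of I i0] K0 norm_mult norm_power)
  also have "\<dots> \<le> norm (z i0) ^ K * (\<Prod>j\<in>I - {i0}. W ^ K)"
    using each by (intro mult_left_mono prod_mono) auto
  also have "(\<Prod>j\<in>I - {i0}. W ^ K) = (W ^ (card I - 1)) ^ K"
    using I by (simp add: power_mult[symmetric] mult.commute)
  also have "\<dots> \<le> (W ^ card I) ^ K" using W by (intro power_mono power_increasing) auto
  finally have "1 ^ K \<le> (norm (z i0) * W ^ card I) ^ K"
    by (simp add: power_mult_distrib mult_left_mono)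
  hence "1 \<le> norm (z i0) * W ^ card I" using K0 W by (subst (asm) power_mono_iff) auto
  thus ?thesis using W by (simp add: field_simps)
qed

lemma algebraic_int_powi: "algebraic_int (x :: complex) \<Longrightarrow> k \<ge> 0 \<Longrightarrow> algebraic_int (x powi k)"
  using subring_power[OF is_subring_algebraic_ints] by (simp add: power_int_def)

text \<open>The integral counterpart of the previous bound, covering all primes at once without
  valuations: the relation is rewritten as a monic equation for the quotient with algebraic integers
  as coefficients.\<close>

lemma algebraic_int_of_relation:
  fixes \<gamma> :: "'i \<Rightarrow> complex" and q :: nat
  assumes I: "finite I" "i0 \<in> I" and K: "k i0 > 0" "\<And>j. j \<in> I \<Longrightarrow> \<bar>k j\<bar> \<le> k i0"
    and rel: "(\<Prod>j\<in>I. \<gamma> j powi k j) = of_nat q powi (\<Sum>j\<in>I. k j)"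
    and \<gamma>: "\<And>j. j \<in> I \<Longrightarrow> algebraic_int (\<gamma> j)" "\<And>j. j \<in> I \<Longrightarrow> \<gamma> j \<noteq> 0" "inj_on \<gamma> I" and q: "q > 0"
  shows "algebraic_int (of_nat q ^ card I * (\<Prod>j\<in>I - {i0}. \<gamma> j - \<gamma> i0) / \<gamma> i0)"
proof -
  note A = is_subring_algebraic_ints
  note PA = is_subring_polys_over[OF A]
  define J where "J = I - {i0}"
  have J: "finite J" using I by (simp add: J_def)
  define K where "K = nat (k i0)"
  have K0: "K > 0" "k i0 = int K" using K by (auto simp: K_def)
  define \<delta> where "\<delta> j = \<gamma> j - \<gamma> i0" for j
  define M where "M = of_nat q ^ card I * (\<Prod>j\<in>J. \<delta> j)"
  define x where "x = M / \<gamma> i0"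
  \<comment> \<open>Chosen such that \<open>x + e j = x * \<gamma> j / \<delta> j\<close>, which
    lets every \<open>\<gamma> j\<close> be expressed by \<open>x\<close>; the factor
    \<open>\<delta> j\<close> cancels, so \<open>e j\<close> is an algebraic integer.\<close>
  define e where "e j = M / \<delta> j" for j
  have \<delta>0: "\<delta> j \<noteq> 0" if "j \<in> J" for j
    using that I(2) \<gamma>(3) by (auto simp: \<delta>_def J_def inj_on_def)
  have \<delta>A: "algebraic_int (\<delta> j)" if "j \<in> J" for j
    using that I(2) subring_diff[OF A] \<gamma>(1) by (auto simp: \<delta>_def J_def)
  have M0: "M \<noteq> 0" using \<delta>0 q J by (simp add: M_def)
  have x0: "x \<noteq> 0" using M0 \<gamma>(2) I by (simp add: x_def)
  have qA: "algebraic_int (of_nat q :: complex)" using subring_of_nat[OF A, of q] by simp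
  have eA: "algebraic_int (e j)" if j: "j \<in> J" for j
  proof -
    have "e j = of_nat q ^ card I * (\<Prod>l\<in>J - {j}. \<delta> l)"
      using \<delta>0[OF j] prod.remove[OF J j, of \<delta>] by (simp add: e_def M_def)
    also have "algebraic_int \<dots>"
      using subring_mult[OF A] subring_power[OF A] subring_prod[OF A, of "J - {j}" \<delta>] qA \<delta>A by simp
    finally show ?thesis .
  qed
  define s where "s = (\<Sum>j\<in>I. k j)"
  \<comment> \<open>The constant in \<open>x ^ K = G * (\<Prod>j\<in>J. (\<gamma> j / \<delta> j)
    powi k j)\<close>. The powers of \<open>q\<close> and \<open>\<delta> j\<close> in
    \<open>M ^ K\<close> outweigh any negative exponents, because no exponent exceeds
    \<open>K\<close> in absolute value.\<close>
  define G where "G = M ^ K * of_nat q powi (- s) * (\<Prod>j\<in>J. \<delta> j powi k j)"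
  have GA: "algebraic_int G"
  proof -
    have "G = of_nat q powi (int (card I * K) - s) * (\<Prod>j\<in>J. \<delta> j powi (int K + k j))"
      using \<delta>0 q unfolding G_def M_def
      by (simp add: power_int_add power_int_diff power_int_minus prod.distrib power_mult_distrib
          prod_power_distrib power_mult divide_inverse del: of_nat_mult)
    moreover have "s \<le> int (card I * K)"
    proof -
      have "s \<le> (\<Sum>j\<in>I. int K)" unfolding s_def using K(2) K0 by (intro sum_mono) force
      thus ?thesis by simp
    qed
    moreover have "int K + k j \<ge> 0" if "j \<in> J" for j using K(2)[of j] K0 that by (auto simp: J_def)
    ultimately show ?thesis
      using subring_mult[OF A] subring_prod[OF A, of J "\<lambda>j. \<delta> j powi (int K + k j)"] qA \<delta>A
      by (simp add: algebraic_int_powi)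
  qed
  \<comment> \<open>Splitting \<open>k j = u j - v j\<close> into positive and negative part moves
    the negative powers to the other side of the equation.\<close>
  define u where "u j = nat (k j)" for j
  define v where "v j = nat (- k j)" for j
  define E where "E = (\<lambda>w :: 'i \<Rightarrow> nat. \<Prod>j\<in>J. [:e j, 1:] ^ w j)"
  have EA: "E w \<in> polys_over {x. algebraic_int x}" for w
    unfolding E_def using eA
    by (intro subring_prod[OF PA] subring_power[OF PA]) (auto simp: polys_over_def coeff_pCons split: nat.split)
  have Elc: "lead_coeff (E w) = 1" for w by (simp add: E_def lead_coeff_prod lead_coeff_power)
  have Edeg: "degree (E w) = sum w J" for w
    by (simp add: E_def degree_prod_eq_sum_degree degree_power_eq)
  define P1 where "P1 = monom 1 (K + sum u J) * E v"
  define P2 where "P2 = Polynomial.smult G (monom 1 (sum v J) * E u)"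
  define p where "p = P1 - P2"
  have mono: "monom 1 i \<in> polys_over {x :: complex. algebraic_int x}" for i
    by (intro monom_in_polys_over A) auto
  have pA: "p \<in> polys_over {x. algebraic_int x}"
    unfolding p_def P1_def P2_def using GA
    by (intro subring_diff[OF PA] subring_mult[OF PA] smult_in_polys_over[OF A] mono EA) auto
  \<comment> \<open>Both sides carry \<open>sum u J + sum v J\<close> in their degree; the
    additional \<open>K > 0\<close> makes the monic side \<open>P1\<close> dominate.\<close>
  have p1: "lead_coeff p = 1"
  proof -
    have E0: "E w \<noteq> 0" for w using Elc[of w] by auto
    have "degree (- P2) \<le> degree (monom (1::complex) (sum v J) * E u)"
      by (simp add: P2_def degree_smult_le)
    also have "\<dots> = sum v J + sum u J"
      by (subst degree_mult_eq) (simp_all add: E0 Edeg degree_monom_eq)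
    also have "\<dots> < K + sum u J + sum v J" using K0 by simp
    also have "\<dots> = degree P1"
      unfolding P1_def by (subst degree_mult_eq) (simp_all add: E0 Edeg degree_monom_eq)
    finally have "lead_coeff (- P2 + P1) = lead_coeff P1" by (rule lead_coeff_add_le)
    also have "\<dots> = 1" by (simp add: P1_def lead_coeff_mult Elc degree_monom_eq)
    finally show ?thesis by (simp add: p_def)
  qed
  have px: "poly p x = 0"
  proof -
    define \<rho> where "\<rho> j = \<gamma> j / \<delta> j" for j
    have xe: "x + e j = x * \<rho> j" if "j \<in> J" for j
      using \<delta>0[OF that] \<gamma>(2)[OF I(2)] by (simp add: x_def e_def \<rho>_def \<delta>_def field_simps)
    have pE: "poly (E w) x = x ^ sum w J * (\<Prod>j\<in>J. \<rho> j ^ w j)" for w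
    proof -
      have "poly (E w) x = (\<Prod>j\<in>J. (x * \<rho> j) ^ w j)"
        unfolding E_def poly_prod by (intro prod.cong) (auto simp: xe[symmetric] add.commute)
      thus ?thesis by (simp add: power_mult_distrib prod.distrib power_sum)
    qed
    have \<rho>0: "\<rho> j \<noteq> 0" if "j \<in> J" for j using \<delta>0[OF that] \<gamma>(2)[of j] that by (auto simp: \<rho>_def J_def)
    have uv: "\<rho> j ^ u j = \<rho> j powi k j * \<rho> j ^ v j" if "j \<in> J" for j
      using \<rho>0[OF that] by (simp add: u_def v_def power_int_def power_inverse)
    have "x ^ K = G * (\<Prod>j\<in>J. \<rho> j powi k j)"
    proof -
      have "\<gamma> i0 ^ K * (\<Prod>j\<in>J. \<gamma> j powi k j) = of_nat q powi s"
        using rel prod.remove[OF I, of "\<lambda>j. \<gamma> j powi k j"] K0 by (simp add: J_def s_def)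
      hence "(\<Prod>j\<in>J. \<gamma> j powi k j) = of_nat q powi s / \<gamma> i0 ^ K"
        using \<gamma>(2)[OF I(2)] by (simp add: field_simps)
      moreover have "(\<Prod>j\<in>J. \<delta> j powi k j) \<noteq> 0" using J \<delta>0 by simp
      moreover have "(of_nat q :: complex) powi s \<noteq> 0" using q by simp
      ultimately show ?thesis
        unfolding G_def x_def \<rho>_def power_int_divide_distrib prod_dividef power_divide
        using q by (simp add: power_int_minus field_simps)
    qed
    hence "x ^ K * (\<Prod>j\<in>J. \<rho> j ^ v j) = G * (\<Prod>j\<in>J. \<rho> j ^ u j)"
      by (simp add: uv prod.distrib)
    hence "poly P1 x = poly P2 x"
      by (simp add: P1_def P2_def pE poly_monom power_add)
    thus ?thesis by (simp add: p_def)
  qed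
  have "algebraic_int x"
    using p1 px by (rule algebraic_int_monic_root) (use pA in \<open>simp add: polys_over_def\<close>)
  thus ?thesis by (simp add: x_def M_def \<delta>_def J_def)
qed

section \<open>Common denominators\<close>

lemma algebraic_imp_multiple_algebraic_int:
  fixes x :: complex
  assumes "algebraic x"
  shows "\<exists>c::nat. c > 0 \<and> algebraic_int (of_nat c * x)"
proof -
  obtain p where p: "\<And>i. coeff p i \<in> \<int>" "p \<noteq> 0" "poly p x = 0"
    using assms by (auto simp: algebraic_def)
  define d where "d = degree p"
  define c where "c = lead_coeff p"
  have c: "c \<noteq> 0" "c \<in> \<int>" using p by (auto simp: c_def)
  have d: "d > 0"
  proof (rule ccontr)
    assume "\<not> d > 0"
    then obtain b where "p = [:b:]" using degree_eq_zeroE[of p] by (auto simp: d_def)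
    thus False using p by simp
  qed
  \<comment> \<open>Multiplying the equation of \<open>x\<close> by \<open>c ^ (d - 1)\<close> turns
    it into a monic equation for \<open>c * x\<close>; \<open>r\<close> is its part below the
    leading term.\<close>
  define r where "r = (\<Sum>i<d. monom (coeff p i * c ^ (d - 1 - i)) i)"
  have "degree r < d"
  proof -
    have "degree r \<le> d - 1" unfolding r_def
      by (intro degree_sum_le) (auto intro: order.trans[OF degree_monom_le])
    thus ?thesis using d by simp
  qed
  hence "lead_coeff (r + monom 1 d) = 1"
    by (subst lead_coeff_add_le) (simp_all add: degree_monom_eq lead_coeff_monom)
  moreover have "coeff (r + monom 1 d) i \<in> \<int>" for i
    unfolding r_def coeff_add coeff_sum coeff_monom
    using p(1) c by (intro Ints_add Ints_sum) (auto intro!: Ints_mult Ints_power)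
  moreover have "poly (r + monom 1 d) (c * x) = 0"
  proof -
    have "poly (r + monom 1 d) (c * x) = c ^ (d - 1) * poly p x"
    proof -
      have px: "poly p x = (\<Sum>i<d. coeff p i * x ^ i) + c * x ^ d"
        by (simp add: poly_altdef d_def c_def lessThan_Suc_atMost[symmetric])
      have low: "coeff p i * c ^ (d - 1 - i) * (c * x) ^ i = c ^ (d - 1) * (coeff p i * x ^ i)" if "i < d" for i
      proof -
        have "c ^ (d - 1) = c ^ (d - 1 - i) * c ^ i" using that by (simp flip: power_add)
        thus ?thesis by (simp add: power_mult_distrib)
      qed
      have top: "(c * x) ^ d = c ^ (d - 1) * (c * x ^ d)"
        using d by (cases d) (simp_all add: power_mult_distrib)
      have "poly r (c * x) = (\<Sum>i<d. c ^ (d - 1) * (coeff p i * x ^ i))"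
        unfolding r_def poly_sum poly_monom by (intro sum.cong) (simp_all only: low lessThan_iff)
      thus ?thesis by (simp add: px top poly_monom sum_distrib_left distrib_left)
    qed
    thus ?thesis using p by simp
  qed
  ultimately have cx: "algebraic_int (c * x)" by (intro algebraic_int.intros[of "r + monom 1 d"] allI)
  obtain z where z: "c = of_int z" using c by (auto elim: Ints_cases)
  have "algebraic_int (of_nat (nat \<bar>z\<bar>) * x)"
    using cx z by (cases "z \<ge> 0") auto
  moreover have "nat \<bar>z\<bar> > 0" using c z by auto
  ultimately show ?thesis by blast
qed

lemma common_denominator:
  fixes A :: "complex set"
  assumes "finite A" "\<And>a. a \<in> A \<Longrightarrow> algebraic a"
  shows "\<exists>q::nat. q > 0 \<and> (\<forall>a\<in>A. algebraic_int (of_nat q * a))"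
  using assms
proof (induction A rule: finite_induct)
  case (insert a A)
  then obtain q where q: "q > 0" "\<forall>a\<in>A. algebraic_int (of_nat q * a)" by auto
  obtain c where c: "c > 0" "algebraic_int (of_nat c * a)"
    using algebraic_imp_multiple_algebraic_int[of a] insert by auto
  have m: "algebraic_int (of_nat m * y)" if "algebraic_int y" for m and y :: complex
    using subring_mult[OF is_subring_algebraic_ints subring_of_nat[OF is_subring_algebraic_ints, of m]] that by simp
  show ?case
    using q c m[of "of_nat c * a" q] m[of "of_nat q * _" c]
    by (intro exI[of _ "q * c"]) (auto simp: mult_ac)
qed (auto intro: exI[of _ 1])

section \<open>The bound on the house\<close>

lemma finite_set_separated:
  fixes U :: "'a::real_normed_vector set"
  assumes "finite U"
  shows "\<exists>\<epsilon>>0. \<epsilon> \<le> 1 \<and> (\<forall>a\<in>U. \<forall>b\<in>U. a \<noteq> b \<longrightarrow> 2 * \<epsilon> \<le> norm (a - b))"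
proof -
  \<comment> \<open>The added value 2 gives \<open>\<epsilon> \<le> 1\<close> and keeps the set
    non-empty when \<open>U\<close> has fewer than two elements.\<close>
  define D where "D = insert 2 ((\<lambda>(a, b). norm (a - b)) ` {(a, b). a \<in> U \<and> b \<in> U \<and> a \<noteq> b})"
  have "finite {(a, b). a \<in> U \<and> b \<in> U \<and> a \<noteq> b}"
    by (rule finite_subset[of _ "U \<times> U"]) (use assms in auto)
  hence D: "finite D" "D \<noteq> {}" by (auto simp: D_def)
  have "Min D > 0" using D by (subst Min_gr_iff) (auto simp: D_def)
  moreover have "Min D \<le> 2" using D by (intro Min_le) (auto simp: D_def)
  moreover have "Min D \<le> norm (a - b)" if "a \<in> U" "b \<in> U" "a \<noteq> b" for a b
    using D that by (intro Min_le) (auto simp: D_def intro!: image_eqI[of _ _ "(a, b)"])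
  ultimately show ?thesis by (intro exI[of _ "Min D / 2"]) auto
qed

lemma prod_powi_const:
  assumes "(x :: 'a::field) \<noteq> 0"
  shows "(\<Prod>i\<in>I. x powi k i) = x powi (\<Sum>i\<in>I. k i)"
  by (induction I rule: infinite_finite_induct) (simp_all add: power_int_add assms)

section \<open>Counting the conjugate relations and bounding the house\<close>

text \<open>Contains the images of the tuple of the \<open>\<alpha> i\<close> and of
  \<open>t\<close> under every homomorphism, with unchanged exponents. Extensional functions keep
  the number of tuples finite.\<close>

definition real_relations :: "'i set \<Rightarrow> ('i \<Rightarrow> int) \<Rightarrow> complex set \<Rightarrow> (('i \<Rightarrow> complex) \<times> complex) set" where
  "real_relations I k U = {(a, T). a \<in> I \<rightarrow>\<^sub>E U \<and> inj_on a I \<and> (\<forall>i\<in>I. a i \<in> \<real>) \<and> T \<in> \<real> \<and>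
     (\<forall>i\<in>I. a i + T \<noteq> 0) \<and> (\<Prod>i\<in>I. (a i + T) powi k i) = 1}"

text \<open>There are at most \<open>card U ^ card I\<close> tuples, and each admits at most
  \<open>2 * card I + 1\<close> values of \<open>T\<close>. The bound is independent of
  \<open>k\<close>.\<close>

lemma card_real_relations:
  assumes I: "finite I" and i0: "i0 \<in> I" "k i0 \<noteq> 0" and U: "finite U"
  shows "finite (real_relations I k U) \<and> card (real_relations I k U) \<le> card U ^ card I * (2 * card I + 1)"
proof -
  define R where "R a = {x. (\<forall>i\<in>I. Re (a i) + x \<noteq> 0) \<and> (\<Prod>i\<in>I. (Re (a i) + x) powi k i) = 1}"
    for a :: "'a \<Rightarrow> complex"
  define X where "X = {a \<in> I \<rightarrow>\<^sub>E U. inj_on a I \<and> (\<forall>i\<in>I. a i \<in> \<real>)}"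
  have XU: "X \<subseteq> I \<rightarrow>\<^sub>E U" by (auto simp: X_def)
  have finX: "finite X" using finite_PiE[of I "\<lambda>_. U"] I U by (intro finite_subset[OF XU]) auto
  have "card X \<le> card (I \<rightarrow>\<^sub>E U)" using finite_PiE[of I "\<lambda>_. U"] I U XU by (intro card_mono) auto
  hence cardX: "card X \<le> card U ^ card I" using I by (simp add: card_PiE)
  have R: "finite (R a) \<and> card (R a) \<le> 2 * card I + 1" if a: "a \<in> X" for a
  proof -
    have "inj_on (\<lambda>i. Re (a i)) I"
    proof (rule inj_onI)
      fix i j assume ij: "i \<in> I" "j \<in> I" "Re (a i) = Re (a j)"
      hence "a i = a j" using a by (auto simp: X_def complex_is_Real_iff complex_eq_iff)
      thus "i = j" using a ij by (auto simp: X_def inj_on_def)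
    qed
    from real_relation_solutions[where k = k, OF I this i0] show ?thesis by (simp add: R_def)
  qed
  have "real_relations I k U \<subseteq> (SIGMA a:X. complex_of_real ` R a)"
  proof (clarsimp simp: real_relations_def, intro conjI)
    fix a T assume aT: "a \<in> I \<rightarrow>\<^sub>E U" "inj_on a I" "\<forall>i\<in>I. a i \<in> \<real>" "T \<in> \<real>"
      "\<forall>i\<in>I. a i + T \<noteq> 0" "(\<Prod>i\<in>I. (a i + T) powi k i) = 1"
    show "a \<in> X" using aT by (auto simp: X_def)
    have T: "T = of_real (Re T)" using aT by (simp add: complex_is_Real_iff complex_eq_iff)
    have ai: "a i + T = of_real (Re (a i) + Re T)" if "i \<in> I" for i
      using aT that by (simp add: complex_is_Real_iff complex_eq_iff)
    have "complex_of_real (\<Prod>i\<in>I. (Re (a i) + Re T) powi k i) = (\<Prod>i\<in>I. (a i + T) powi k i)"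
      unfolding of_real_prod by (intro prod.cong) (simp_all add: ai)
    hence "(\<Prod>i\<in>I. (Re (a i) + Re T) powi k i) = 1" using aT(6) by (metis of_real_eq_1_iff)
    moreover have "Re (a i) + Re T \<noteq> 0" if "i \<in> I" for i using ai[OF that] aT(5) that by (metis of_real_0)
    ultimately have "Re T \<in> R a" by (simp add: R_def)
    thus "T \<in> complex_of_real ` R a" using T by blast
  qed
  moreover have finS: "finite (SIGMA a:X. complex_of_real ` R a)" using finX R by auto
  moreover have "card (SIGMA a:X. complex_of_real ` R a) \<le> card U ^ card I * (2 * card I + 1)"
  proof -
    have "card (SIGMA a:X. complex_of_real ` R a) = (\<Sum>a\<in>X. card (complex_of_real ` R a))"
      using finX R by (intro card_SigmaI) auto
    also have "\<dots> \<le> (\<Sum>a\<in>X. 2 * card I + 1)"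
      using R by (intro sum_mono) (meson card_image_le order.trans)
    also have "\<dots> = card X * (2 * card I + 1)" by simp
    also have "\<dots> \<le> card U ^ card I * (2 * card I + 1)" using cardX by (intro mult_right_mono) auto
    finally show ?thesis .
  qed
  ultimately show ?thesis by (meson card_mono finite_subset order.trans)
qed

text \<open>The other factors contribute at most \<open>B ^ E\<close>, so the factor at
  \<open>z\<close> cannot be smaller than the inverse of that.\<close>

lemma norm_ge_if_prod_ge_1:
  fixes B :: real
  assumes C: "finite C" "card C \<le> E" and B: "B \<ge> 1" "\<And>z. z \<in> C \<Longrightarrow> norm z \<le> B"
    and ge: "1 \<le> (\<Prod>z\<in>C. norm z)" and z: "z \<in> C"
  shows "1 \<le> norm z * B ^ E"
proof -
  have "1 \<le> norm z * (\<Prod>w\<in>C - {z}. norm w)" using ge prod.remove[OF C(1) z, of norm] by simp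
  also have "\<dots> \<le> norm z * (\<Prod>w\<in>C - {z}. B)" using B by (intro mult_left_mono prod_mono) auto
  also have "\<dots> \<le> norm z * B ^ E"
    using B C z by (auto intro!: mult_left_mono power_increasing)
  finally show ?thesis .
qed

text \<open>The bound involves neither \<open>t\<close> nor \<open>k\<close>. When a conjugate of
  \<open>\<alpha> i0 + t\<close> is below \<open>\<epsilon>\<close>, the other factors lie between
  \<open>1 / W\<close> and \<open>W\<close>; \<open>c\<close> bounds the conjugates of
  \<open>\<alpha> i0 + t\<close> from below, \<open>M\<close> bounds the numerators of the
  conjugates of \<open>y\<close> from above, and \<open>E\<close> bounds their number.\<close>

lemma house_le_of_relation:
  fixes \<alpha> :: "'i \<Rightarrow> complex" and q :: nat and A \<epsilon> :: real
  assumes I: "finite I" "i0 \<in> I" and inj: "inj_on \<alpha> I" and real: "\<And>i. i \<in> I \<Longrightarrow> totally_real (\<alpha> i)"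
    and A: "A \<ge> 1" "\<And>i a. i \<in> I \<Longrightarrow> a \<in> conjugates (\<alpha> i) \<Longrightarrow> norm a \<le> A"
    and \<epsilon>: "\<epsilon> > 0" "\<epsilon> \<le> 1"
      "\<And>i j a b. i \<in> I \<Longrightarrow> j \<in> I \<Longrightarrow> a \<in> conjugates (\<alpha> i) \<Longrightarrow> b \<in> conjugates (\<alpha> j) \<Longrightarrow> a \<noteq> b \<Longrightarrow>
         2 * \<epsilon> \<le> norm (a - b)"
    and q: "q > 0" "\<And>i. i \<in> I \<Longrightarrow> algebraic_int (of_nat q * \<alpha> i)"
    and t: "algebraic_int t" "totally_real t"
    and K: "k i0 > 0" "\<And>j. j \<in> I \<Longrightarrow> \<bar>k j\<bar> \<le> k i0"
    and nz: "\<And>i. i \<in> I \<Longrightarrow> \<alpha> i + t \<noteq> 0" and rel: "(\<Prod>i\<in>I. (\<alpha> i + t) powi k i) = 1"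
  defines "W \<equiv> max (2 * A + 1) (1 / \<epsilon>)"
  defines "c \<equiv> min \<epsilon> (1 / W ^ card I)"
  defines "M \<equiv> real q ^ card I * (2 * real q * A) ^ card I"
  defines "E \<equiv> card (\<Union>i\<in>I. conjugates (\<alpha> i)) ^ card I * (2 * card I + 1)"
  shows "house t \<le> M * (M / c) ^ E + A"
proof -
  define U where "U = (\<Union>i\<in>I. conjugates (\<alpha> i))"
  define J where "J = I - {i0}"
  have alg: "algebraic (\<alpha> i)" if "i \<in> I" for i using real[OF that] by (simp add: totally_real_def)
  have talg: "algebraic t" using t(1) by auto
  have U: "finite U" unfolding U_def using I alg finite_conjugates by blast
  have W: "W \<ge> 1" "1 / W \<le> \<epsilon>" "2 * A + \<epsilon> \<le> W"
  proof -
    show "W \<ge> 1" "2 * A + \<epsilon> \<le> W" using A \<epsilon> by (auto simp: W_def)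
    have "1 / \<epsilon> \<le> W" by (simp add: W_def)
    thus "1 / W \<le> \<epsilon>" using \<epsilon> \<open>W \<ge> 1\<close> by (simp add: field_simps)
  qed
  have c: "c > 0" "c \<le> 1" using W \<epsilon> by (auto simp: c_def)
  have qA: "2 * real q * A \<ge> 1"
    using mult_mono[of 1 "2 * real q" 1 A] q A by simp
  have M1: "M \<ge> 1" unfolding M_def using mult_mono[of 1 "real q ^ card I" 1 "(2 * real q * A) ^ card I"] qA q
    by (simp add: one_le_power)
  have B1: "M / c \<ge> 1" using M1 c by (simp add: field_simps)
  \<comment> \<open>Written for an arbitrary tuple \<open>a\<close>, so that a homomorphism turns
    \<open>Y \<alpha> t\<close> into \<open>Y a T\<close> for the conjugate data.\<close>
  define N where "N a = of_nat q ^ card I * (\<Prod>j\<in>J. of_nat q * (a j - a i0))" for a :: "'i \<Rightarrow> complex"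
  define Y where "Y a T = N a / (of_nat q * (a i0 + T))" for a :: "'i \<Rightarrow> complex" and T
  define y where "y = Y \<alpha> t"

  have y_int: "algebraic_int y"
  proof -
    note AI = is_subring_algebraic_ints
    define \<gamma> where "\<gamma> j = of_nat q * (\<alpha> j + t)" for j
    have "algebraic_int (of_nat q * \<alpha> j + of_nat q * t)" if "j \<in> I" for j
      using subring_add[OF AI] subring_mult[OF AI subring_of_nat[OF AI, of q]] q(2)[OF that] t by simp
    hence "algebraic_int (\<gamma> j)" if "j \<in> I" for j using that by (simp add: \<gamma>_def distrib_left)
    moreover have "\<gamma> j \<noteq> 0" if "j \<in> I" for j using nz[OF that] q by (simp add: \<gamma>_def)
    moreover have "inj_on \<gamma> I" using inj q by (auto simp: inj_on_def \<gamma>_def)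
    moreover have "(\<Prod>j\<in>I. \<gamma> j powi k j) = of_nat q powi (\<Sum>j\<in>I. k j)"
      using rel q by (simp add: \<gamma>_def power_int_mult_distrib prod.distrib prod_powi_const)
    ultimately have "algebraic_int (of_nat q ^ card I * (\<Prod>j\<in>I - {i0}. \<gamma> j - \<gamma> i0) / \<gamma> i0)"
      using I K q(1) by (intro algebraic_int_of_relation[of I i0 k \<gamma> q])
    also have "of_nat q ^ card I * (\<Prod>j\<in>I - {i0}. \<gamma> j - \<gamma> i0) / \<gamma> i0 = y"
      by (simp add: y_def Y_def N_def \<gamma>_def J_def algebra_simps)
    finally show ?thesis .
  qed
  have N0: "N \<alpha> \<noteq> 0" using q I inj by (auto simp: N_def J_def inj_on_def)
  hence y0: "y \<noteq> 0" using nz[OF I(2)] q by (simp add: y_def Y_def)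
  have yalg: "algebraic y" using y_int by auto

  \<comment> \<open>Everything that one homomorphism yields about the conjugate data; it serves
    below for the conjugates of \<open>y\<close> as well as for those of \<open>t\<close>.\<close>
  have hom: "\<phi> y = Y a T \<and> (restrict a I, T) \<in> real_relations I k U \<and>
      c \<le> norm (a i0 + T) \<and> norm (N a) \<le> M \<and> norm (a i0) \<le> A"
    if F: "is_subfield F" "is_hom_on F \<phi>" "\<alpha> ` I \<subseteq> F" "t \<in> F" and a: "a = (\<lambda>i. \<phi> (\<alpha> i))" and T: "T = \<phi> t"
    for F \<phi> a T
  proof -
    note R = subfield_subring[OF F(1)]
    have \<alpha>F: "\<alpha> i \<in> F" if "i \<in> I" for i using F(3) that by blast
    have sF: "\<alpha> i + t \<in> F" if "i \<in> I" for i using \<alpha>F[OF that] F(4) by (intro subring_add[OF R])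
    have aT: "\<phi> (\<alpha> i + t) = a i + T" if "i \<in> I" for i
      using hom_add[OF F(1,2) \<alpha>F[OF that] F(4)] by (simp add: a T)
    have ai: "a i \<in> conjugates (\<alpha> i)" if "i \<in> I" for i
      using hom_conjugate[OF F(1,2) alg[OF that] \<alpha>F[OF that]] by (simp add: a)
    have Tc: "T \<in> conjugates t" using hom_conjugate[OF F(1,2) talg F(4)] by (simp add: T)
    have ainj: "inj_on a I"
      using hom_eq_iff[OF F(1,2) \<alpha>F \<alpha>F] inj by (auto simp: inj_on_def a)
    have anz: "a i + T \<noteq> 0" if "i \<in> I" for i
      using hom_eq_0_iff[OF F(1,2) sF[OF that]] aT[OF that] nz[OF that] by simp
    have "\<phi> (\<Prod>i\<in>I. (\<alpha> i + t) powi k i) = (\<Prod>i\<in>I. \<phi> ((\<alpha> i + t) powi k i))"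
      by (intro hom_prod[OF F(1,2)] subfield_powi[OF F(1)] sF)
    also have "\<dots> = (\<Prod>i\<in>I. (a i + T) powi k i)"
      by (intro prod.cong refl) (simp add: hom_powi[OF F(1,2) sF] aT)
    finally have arel: "(\<Prod>i\<in>I. (a i + T) powi k i) = 1" by (simp add: rel hom_1[OF F(1,2)])
    have aR: "a i \<in> \<real>" if "i \<in> I" for i
      using ai[OF that] real[OF that] unfolding totally_real_def by blast
    have "(restrict a I, T) \<in> real_relations I k U"
      using ai aR Tc ainj anz arel t(2)
      by (auto simp: real_relations_def U_def totally_real_def inj_on_def)
    moreover have "\<phi> y = Y a T"
    proof -
      note qF = subring_of_nat[OF R, of q]
      have dF: "of_nat q * (\<alpha> j - \<alpha> i0) \<in> F" if "j \<in> J" for j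
        using that I \<alpha>F by (intro subring_mult[OF R] subring_diff[OF R] qF) (auto simp: J_def)
      have pF: "of_nat q ^ card I \<in> F" "(\<Prod>j\<in>J. of_nat q * (\<alpha> j - \<alpha> i0)) \<in> F"
        by (intro subring_power[OF R] qF) (intro subring_prod[OF R] dF)
      have NF: "N \<alpha> \<in> F" unfolding N_def by (intro subring_mult[OF R] pF)
      have "\<phi> (of_nat q * (\<alpha> j - \<alpha> i0)) = of_nat q * (a j - a i0)" if "j \<in> J" for j
      proof -
        have j: "\<alpha> j \<in> F" "\<alpha> i0 \<in> F" using that I \<alpha>F by (auto simp: J_def)
        show ?thesis
          using hom_mult[OF F(1,2) qF subring_diff[OF R j]] hom_diff[OF F(1,2) j] hom_of_nat[OF F(1,2), of q]
          by (simp add: a)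
      qed
      moreover have "\<phi> (\<Prod>j\<in>J. of_nat q * (\<alpha> j - \<alpha> i0)) = (\<Prod>j\<in>J. \<phi> (of_nat q * (\<alpha> j - \<alpha> i0)))"
        by (rule hom_prod[OF F(1,2) dF])
      ultimately have "\<phi> (N \<alpha>) = N a"
        unfolding N_def hom_mult[OF F(1,2) pF] hom_power[OF F(1,2) qF] by (simp add: hom_of_nat[OF F(1,2)])
      moreover have "\<phi> (of_nat q * (\<alpha> i0 + t)) = of_nat q * (a i0 + T)"
        using hom_mult[OF F(1,2) qF sF[OF I(2)]] hom_of_nat[OF F(1,2), of q] aT[OF I(2)] by simp
      ultimately show ?thesis
        unfolding y_def Y_def using hom_divide[OF F(1,2) NF subring_mult[OF R qF sF[OF I(2)]]] by simp
    qed
    moreover have "c \<le> norm (a i0 + T)"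
    proof (cases "\<epsilon> \<le> norm (a i0 + T)")
      case True
      thus ?thesis by (simp add: c_def)
    next
      case False
      \<comment> \<open>Distinct conjugates are at least \<open>2 * \<epsilon>\<close> apart and
        \<open>a i0 + T\<close> is smaller than \<open>\<epsilon>\<close>, so the other factors lie
        between \<open>\<epsilon>\<close> and \<open>2 * A + \<epsilon>\<close>.\<close>
      have "1 / W ^ card I \<le> norm (a i0 + T)"
      proof (rule prod_powi_eq_1_lower_bound[where z = "\<lambda>i. a i + T" and k = k])
        fix j assume j: "j \<in> I - {i0}"
        have eq: "a j + T = (a j - a i0) + (a i0 + T)" by simp
        have "a j \<noteq> a i0" using j I ainj by (auto simp: inj_on_def)
        hence "2 * \<epsilon> \<le> norm (a j - a i0)" using \<epsilon>(3) ai j I by blast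
        moreover have "norm (a j - a i0) \<le> norm (a j + T) + norm (a i0 + T)"
          using norm_triangle_ineq4[of "a j + T" "a i0 + T"] by simp
        moreover have "norm (a j + T) \<le> norm (a j - a i0) + norm (a i0 + T)"
          using norm_triangle_ineq[of "a j - a i0" "a i0 + T"] by simp
        moreover have "norm (a j - a i0) \<le> norm (a j) + norm (a i0)" by (rule norm_triangle_ineq4)
        moreover have "norm (a j) \<le> A" "norm (a i0) \<le> A" using A(2) ai j I by blast+
        ultimately show "1 / W \<le> norm (a j + T) \<and> norm (a j + T) \<le> W" using False W by linarith
      qed (use I K arel W in auto)
      thus ?thesis by (simp add: c_def)
    qed
    moreover have "norm (N a) \<le> M"
    proof -
      have "norm (of_nat q * (a j - a i0)) \<le> 2 * real q * A" if j: "j \<in> J" for j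
      proof -
        have "norm (a j - a i0) \<le> norm (a j) + norm (a i0)" by (rule norm_triangle_ineq4)
        moreover have "norm (a j) \<le> A" "norm (a i0) \<le> A" using A(2) ai j I unfolding J_def by blast+
        ultimately have "norm (a j - a i0) \<le> 2 * A" by linarith
        from mult_left_mono[OF this, of "real q"] show ?thesis by (simp add: norm_mult mult_ac)
      qed
      hence "(\<Prod>j\<in>J. norm (of_nat q * (a j - a i0))) \<le> (\<Prod>j\<in>J. 2 * real q * A)"
        by (intro prod_mono) auto
      also have "\<dots> = (2 * real q * A) ^ card J" by simp
      also have "\<dots> \<le> (2 * real q * A) ^ card I"
        using qA I by (intro power_increasing) (auto simp: J_def card_Diff_singleton_if)
      finally show ?thesis
        unfolding N_def M_def norm_mult norm_power prod_norm[symmetric] norm_of_nat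
        by (intro mult_left_mono) auto
    qed
    moreover have "norm (a i0) \<le> A" using A(2) ai I by blast
    ultimately show ?thesis by blast
  qed

  have fin: "finite (insert t (\<alpha> ` I))" using I by simp
  have finalg: "algebraic x" if "x \<in> insert t (\<alpha> ` I)" for x using that alg talg by auto
  have conj: "norm z \<le> M / c \<and> z \<in> (\<lambda>(a, T). Y a T) ` real_relations I k U" if z: "z \<in> conjugates y" for z
  proof -
    obtain F \<phi> where F: "is_subfield F" "is_hom_on F \<phi>" "\<phi> y = z" "insert t (\<alpha> ` I) \<subseteq> F"
      using conjugate_hom[OF yalg z fin finalg] by metis
    define a where "a = (\<lambda>i. \<phi> (\<alpha> i))"
    define T where "T = \<phi> t"
    have h: "z = Y a T" "(restrict a I, T) \<in> real_relations I k U" "c \<le> norm (a i0 + T)" "norm (N a) \<le> M"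
      using hom[OF F(1,2) _ _ a_def T_def] F(3,4) by auto
    \<comment> \<open>\<open>Y\<close> reads only the indices in \<open>I\<close>, so passing to the
      extensional tuple demanded by \<open>real_relations\<close> is harmless.\<close>
    have "Y (restrict a I) T = Y a T"
      using I unfolding Y_def N_def by (auto simp: J_def intro!: prod.cong)
    hence "z \<in> (\<lambda>(a, T). Y a T) ` real_relations I k U"
      using h by (intro image_eqI[OF _ h(2)]) simp
    moreover have "norm z \<le> M / c"
    proof -
      have "c \<le> real q * norm (a i0 + T)"
        using h(3) q(1) mult_mono[of 1 "real q" c "norm (a i0 + T)"] c by simp
      hence "norm (N a) / (real q * norm (a i0 + T)) \<le> M / c"
        using h(4) c M1 by (intro frac_le) auto
      thus ?thesis by (simp add: h(1) Y_def norm_divide norm_mult)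
    qed
    ultimately show ?thesis by blast
  qed
  have "card (conjugates y) \<le> E"
  proof -
    have rr: "finite (real_relations I k U)" "card (real_relations I k U) \<le> E"
      using card_real_relations[where k = k, OF I _ U] K by (auto simp: E_def U_def)
    have "card (conjugates y) \<le> card ((\<lambda>(a, T). Y a T) ` real_relations I k U)"
      using conj rr by (intro card_mono) auto
    also have "\<dots> \<le> E" using card_image_le[OF rr(1)] rr(2) order.trans by blast
    finally show ?thesis .
  qed
  hence lower: "1 \<le> norm z * (M / c) ^ E" if "z \<in> conjugates y" for z
    using norm_ge_if_prod_ge_1[OF finite_conjugates[OF yalg] _ B1 _ prod_norm_conjugates_ge_1[OF y_int y0] that] conj
    by blast

  have "norm t' \<le> M * (M / c) ^ E + A" if t': "t' \<in> conjugates t" for t'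
  proof -
    obtain F \<phi> where F: "is_subfield F" "is_hom_on F \<phi>" "\<phi> t = t'" "t \<in> F" "insert y (\<alpha> ` I) \<subseteq> F"
    proof (rule conjugate_hom[OF talg t', of "insert y (\<alpha> ` I)"])
      show "finite (insert y (\<alpha> ` I))" using I by simp
      show "algebraic x" if "x \<in> insert y (\<alpha> ` I)" for x using that yalg alg by auto
    qed
    define a where "a = (\<lambda>i. \<phi> (\<alpha> i))"
    have h: "\<phi> y = Y a t'" "c \<le> norm (a i0 + t')" "norm (N a) \<le> M" "norm (a i0) \<le> A"
      using hom[OF F(1,2) _ F(4) a_def F(3)[symmetric]] F(5) by auto
    \<comment> \<open>The image of \<open>y\<close> is a conjugate of \<open>y\<close> and cannot be
      too small, whereas its absolute value is at most \<open>M / norm (a i0 + t')\<close>; this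
      limits \<open>t'\<close>.\<close>
    have "1 \<le> norm (Y a t') * (M / c) ^ E"
      using lower hom_conjugate[OF F(1,2) yalg] F(5) h(1) by auto
    moreover have pos: "norm (a i0 + t') > 0" using h(2) c by linarith
    moreover have "norm (Y a t') \<le> M / norm (a i0 + t')"
    proof -
      have "norm (a i0 + t') \<le> real q * norm (a i0 + t')"
        using q(1) mult_right_mono[of 1 "real q" "norm (a i0 + t')"] by simp
      hence "norm (N a) / (real q * norm (a i0 + t')) \<le> M / norm (a i0 + t')"
        using h(3) M1 pos by (intro frac_le) auto
      thus ?thesis by (simp add: Y_def norm_divide norm_mult)
    qed
    moreover have "(M / c) ^ E \<ge> 0" using B1 by (intro zero_le_power) simp
    ultimately have "1 \<le> M / norm (a i0 + t') * (M / c) ^ E"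
      by (meson mult_right_mono order.trans)
    hence "norm (a i0 + t') \<le> M * (M / c) ^ E"
      using pos by (simp only: times_divide_eq_left pos_le_divide_eq mult_1_left)
    moreover have "norm t' \<le> norm (a i0 + t') + norm (a i0)"
      using norm_triangle_ineq4[of "a i0 + t'" "a i0"] by simp
    ultimately show ?thesis using h(4) by linarith
  qed
  moreover have "conjugates t \<noteq> {}" using conjugates_self[OF talg] by blast
  ultimately show ?thesis
    unfolding house_def using finite_conjugates[OF talg] by (subst Max_le_iff) auto
qed

text \<open>Here \<open>t = - a\<close>, so the conjugates of \<open>t\<close> are the negatives of
  those of \<open>a\<close>. This excludes zero coordinates once the house of \<open>t\<close> is
  large.\<close>

lemma house_le_if_negative:
  assumes t: "algebraic t" "algebraic a" "a + t = 0" and A: "\<And>b. b \<in> conjugates a \<Longrightarrow> norm b \<le> A"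
  shows "house t \<le> A"
proof -
  have "norm t' \<le> A" if t': "t' \<in> conjugates t" for t'
  proof -
    obtain F \<phi> where F: "is_subfield F" "is_hom_on F \<phi>" "\<phi> t = t'" "t \<in> F" "{a} \<subseteq> F"
      by (rule conjugate_hom[OF t(1) t', of "{a}"]) (use t(2) in auto)
    have "a = - t" using t(3) by (simp add: eq_neg_iff_add_eq_0)
    hence "\<phi> a = - t'" using hom_uminus[OF F(1,2,4)] F(3) by simp
    thus ?thesis using A hom_conjugate[OF F(1,2) t(2)] F(5) by (metis insert_subset norm_minus_cancel)
  qed
  moreover have "conjugates t \<noteq> {}" using conjugates_self[OF t(1)] by blast
  ultimately show ?thesis
    unfolding house_def using finite_conjugates[OF t(1)] by (subst Max_le_iff) auto
qed

theorem theorem3p2: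
  fixes n :: nat and \<alpha> :: "nat \<Rightarrow> complex"
  assumes "n \<ge> 2"
    and "inj_on \<alpha> {1..n}"
    and "\<forall>i\<in>{1..n}. totally_real (\<alpha> i)"
  shows "\<exists>C::real. C > 0 \<and>
    (\<forall>t::complex. algebraic_int t \<and> totally_real t \<and> house t \<ge> C \<longrightarrow>
       mult_independent n (\<lambda>i. \<alpha> i + t))"
proof -
  define I where "I = {1..n}"
  have real: "totally_real (\<alpha> i)" and alg: "algebraic (\<alpha> i)" if "i \<in> I" for i
    using assms(3) that by (auto simp: I_def totally_real_def)
  have I: "finite I" by (simp add: I_def)
  define U where "U = (\<Union>i\<in>I. conjugates (\<alpha> i))"
  have U: "finite U" unfolding U_def using I alg finite_conjugates by blast
  define A where "A = Max (insert 1 (norm ` U))"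
  have A1: "A \<ge> 1" using U by (simp add: A_def)
  have A: "norm a \<le> A" if "i \<in> I" "a \<in> conjugates (\<alpha> i)" for i a
    unfolding A_def using U that by (intro Max_ge) (auto simp: U_def)
  obtain \<epsilon> where \<epsilon>: "\<epsilon> > 0" "\<epsilon> \<le> 1" "\<forall>a\<in>U. \<forall>b\<in>U. a \<noteq> b \<longrightarrow> 2 * \<epsilon> \<le> norm (a - b)"
    using finite_set_separated[OF U] by blast
  have \<epsilon>': "2 * \<epsilon> \<le> norm (a - b)"
    if "i \<in> I" "j \<in> I" "a \<in> conjugates (\<alpha> i)" "b \<in> conjugates (\<alpha> j)" "a \<noteq> b" for i j a b
    using \<epsilon>(3) that unfolding U_def by blast
  obtain q :: nat where q: "q > 0" "\<forall>a\<in>\<alpha> ` I. algebraic_int (of_nat q * a)"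
    using common_denominator[of "\<alpha> ` I"] I alg by auto
  have q': "algebraic_int (of_nat q * \<alpha> i)" if "i \<in> I" for i using q(2) that by blast
  define W where "W = max (2 * A + 1) (1 / \<epsilon>)"
  define c where "c = min \<epsilon> (1 / W ^ card I)"
  define M where "M = real q ^ card I * (2 * real q * A) ^ card I"
  define E where "E = card U ^ card I * (2 * card I + 1)"
  \<comment> \<open>The summand 1 makes the bound of \<open>house_le_of_relation\<close> strictly
    smaller than \<open>C\<close>; \<open>C > A\<close> rules out zero coordinates.\<close>
  define C where "C = M * (M / c) ^ E + A + 1"
  have "c \<ge> 0" using A1 \<epsilon> by (auto simp: c_def W_def)
  moreover have "M \<ge> 0" using A1 by (simp add: M_def)
  ultimately have "M * (M / c) ^ E \<ge> 0" by simp
  hence C: "C > 0" "C > A" using A1 by (auto simp: C_def)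
  have "mult_independent n (\<lambda>i. \<alpha> i + t)" if t: "algebraic_int t" "totally_real t" "house t \<ge> C" for t
  proof -
    have nz: "\<alpha> i + t \<noteq> 0" if i: "i \<in> I" for i
      using house_le_if_negative[of t "\<alpha> i" A] A[OF i] alg[OF i] t C(2) by force
    have bound: False
      if i0: "i0 \<in> I" and K: "k i0 > 0" "\<And>j. j \<in> I \<Longrightarrow> \<bar>k j\<bar> \<le> k i0"
        and rel: "(\<Prod>i\<in>I. (\<alpha> i + t) powi k i) = 1" for i0 and k :: "nat \<Rightarrow> int"
    proof -
      have "house t \<le> M * (M / c) ^ E + A"
        unfolding M_def c_def W_def E_def U_def
        using house_le_of_relation[where k = k, OF I i0 assms(2)[folded I_def] real A1 A \<epsilon>(1,2) \<epsilon>' q(1) q' t(1,2) K nz rel] .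
      thus False using t(3) by (simp add: C_def)
    qed
    have "\<not> mult_dependent n (\<lambda>i. \<alpha> i + t)"
    proof
      assume "mult_dependent n (\<lambda>i. \<alpha> i + t)"
      then obtain k i1 where k: "i1 \<in> I" "k i1 \<noteq> 0" "(\<Prod>i\<in>I. (\<alpha> i + t) powi k i) = 1"
        by (auto simp: mult_dependent_def I_def)
      have ne: "(\<lambda>i. \<bar>k i\<bar>) ` I \<noteq> {}" using k by auto
      obtain i0 where i0: "i0 \<in> I" "\<bar>k i0\<bar> = Max ((\<lambda>i. \<bar>k i\<bar>) ` I)"
        using Max_in[OF _ ne] I by auto
      have max: "\<bar>k j\<bar> \<le> \<bar>k i0\<bar>" if "j \<in> I" for j
        unfolding i0(2) using I that by (intro Max_ge) auto
      have k0: "k i0 \<noteq> 0" using max[OF k(1)] k(2) by auto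
      show False
      proof (cases "k i0 > 0")
        case True
        thus False using bound[OF i0(1), of k] max k(3) by auto
      next
        case False
        \<comment> \<open>Inverting the relation makes the exponent of largest absolute value
          positive.\<close>
        have "(\<Prod>i\<in>I. (\<alpha> i + t) powi (- k i)) = inverse (\<Prod>i\<in>I. (\<alpha> i + t) powi k i)"
          unfolding power_int_minus prod_inversef[symmetric] by (simp add: o_def)
        thus False using bound[OF i0(1), of "\<lambda>i. - k i"] max k(3) False k0 by auto
      qed
    qed
    thus ?thesis using nz by (simp add: mult_independent_def I_def)
  qed
  thus ?thesis using C(1) by blast
qed

end
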